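(* Consider the intercept-only cluster model of the context, under the null $\theta=E[\sum_{i=1}^{N_g}Y_{gi}]=0$. Suppose $(N_g,\sum_{i=1}^{N_g}Y_{gi})$ are i.i.d. across $g$, $E[N_g]=c\in(0,\infty)$, and $N_g$ and $\sum_{i=1}^{N_g}Y_{gi}$ belong to the domain of attraction of stable laws with a common index $\alpha\in(1,2)$. Then the wild cluster bootstrap with Rademacher weights is inconsistent, i.e. it is not true that $$\sup_{t\in\mathbb R}\big|P(T_G^*\le t\mid Y_{1:G})-P(T_G\le t)\big|\xrightarrow{p}0\quad\text{as }G\to\infty.$$
   Context: Clusters $g=1,\dots,G$ have random sizes $N_g\ge1$ and scalar observations $Y_{gi}$, $i=1,\dots,N_g$; $N=\sum_g N_g$; $Y_{1:G}$ denotes all observations. Define $\hat\theta=N^{-1}\sum_g\sum_i Y_{gi}$ and $T_G=\dfrac{\sum_{g=1}^G\sum_{i=1}^{N_g}Y_{gi}}{\sqrt{\sum_{g=1}^G(\sum_{i=1}^{N_g}(Y_{gi}-\hat\theta))^2}}$. Let $v_1^*,\dots,v_G^*$ be i.i.d. Rademacher variables ($\pm1$ with probability $1/2$ each), independent of the data; $\hat\theta^*=N^{-1}\sum_g v_g^*\sum_i Y_{gi}$ and $T_G^*=\dfrac{\sum_{g=1}^G v_g^*\sum_{i=1}^{N_g}Y_{gi}}{\sqrt{\sum_{g=1}^G(v_g^*\sum_{i=1}^{N_g}(Y_{gi}-\hat\theta^* ))^2}}$. Domain of attraction: a real random variable $\xi$ belongs to the domain of attraction of a stable law with index $\alpha\in(0,2]$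 if, for i.i.d. copies $\xi_1,\xi_2,\dots$, there exist $A_G>0$, $D_G\in\mathbb R$ with $(\sum_{g=1}^G\xi_g-D_G)/A_G$ converging in distribution to a nondegenerate random variable, where $A_G=G^{1/\alpha}L(G)$ for a function $L$ slowly varying at $\infty$. *)

theory Defs
  imports "HOL-Probability.Probability"
begin

definition slowly_varying :: "(real \<Rightarrow> real) \<Rightarrow> bool" where
  "slowly_varying L \<longleftrightarrow>
     (\<forall>\<^sub>F x in at_top. L x > 0) \<and>
     (\<forall>l>0. ((\<lambda>x. L (l * x) / L x) \<longlongrightarrow> 1) at_top)"

text \<open>Domain of attraction of a stable law with index alpha, stated for a given
  i.i.d. sequence X 0, X 1, ... of copies of the random variable (on the probability
  space M): there are norming constants A G = G^(1/alpha) L(G) > 0 (L slowly varying)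
  and centring constants D G such that (sum of the first G copies minus D G) / A G
  converges in distribution to a nondegenerate law.\<close>
definition stable_DoA :: "'a measure \<Rightarrow> (nat \<Rightarrow> 'a \<Rightarrow> real) \<Rightarrow> real \<Rightarrow> bool" where
  "stable_DoA M X \<alpha> \<longleftrightarrow> 0 < \<alpha> \<and> \<alpha> \<le> 2 \<and>
     (\<exists>(A :: nat \<Rightarrow> real) (D :: nat \<Rightarrow> real) (L :: real \<Rightarrow> real) (\<mu> :: real measure).
        slowly_varying L \<and>
        (\<forall>G\<ge>1. A G > 0 \<and> A G = real G powr (1 / \<alpha>) * L (real G)) \<and>
        real_distribution \<mu> \<and> \<not> (\<exists>c. \<mu> = return borel c) \<and>
        weak_conv_m (\<lambda>G. distr M borel (\<lambda>\<omega>. ((\<Sum>g<G. X g \<omega>) - D G) / A G)) \<mu>)"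

definition clT :: "nat \<Rightarrow> (nat \<Rightarrow> nat) \<Rightarrow> (nat \<Rightarrow> nat \<Rightarrow> real) \<Rightarrow> real" where
  "clT G n y =
     (let NN = (\<Sum>g<G. real (n g));
          th = (\<Sum>g<G. \<Sum>i<n g. y g i) / NN
      in (\<Sum>g<G. \<Sum>i<n g. y g i) / sqrt (\<Sum>g<G. (\<Sum>i<n g. y g i - th)\<^sup>2))"

definition clTstar :: "nat \<Rightarrow> (nat \<Rightarrow> nat) \<Rightarrow> (nat \<Rightarrow> nat \<Rightarrow> real) \<Rightarrow> (nat \<Rightarrow> real) \<Rightarrow> real" where
  "clTstar G n y v =
     (let NN = (\<Sum>g<G. real (n g));
          th = (\<Sum>g<G. v g * (\<Sum>i<n g. y g i)) / NN
      in (\<Sum>g<G. v g * (\<Sum>i<n g. y g i)) /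
           sqrt (\<Sum>g<G. (v g * (\<Sum>i<n g. y g i - th))\<^sup>2))"

text \<open>Conditional CDF of T*_G given the data, with i.i.d. Rademacher weights independent
  of the data: the average over all 2^G sign vectors (v_0,...,v_{G-1}).\<close>
definition boot_cdf :: "nat \<Rightarrow> (nat \<Rightarrow> nat) \<Rightarrow> (nat \<Rightarrow> nat \<Rightarrow> real) \<Rightarrow> real \<Rightarrow> real" where
  "boot_cdf G n y t =
     (\<Sum>v\<in>PiE {..<G} (\<lambda>_. {-1, 1::real}). if clTstar G n y v \<le> t then 1 else 0) / 2 ^ G"

end

theory Submission
  imports Defs
begin

text \<open>
  Write \<open>S g\<close> for the sum of cluster \<open>g\<close>. With \<open>\<alpha> < 2\<close> a single cluster sum can dominate all the others,
  and so can a pair of comparable ones, each with probability bounded away from 0 along \<open>G = 2 ^ k\<close>.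
  In the first case the bootstrap statistic is close to \<open>\<plusminus>1\<close> for most sign vectors; in the second
  it exceeds \<open>1 + \<rho>\<close> for about a quarter of the sign vectors, for a fixed \<open>\<rho> > 0\<close>. So the bootstrap
  distribution function at \<open>1 + \<rho>\<close> takes two well separated values, each with non-vanishing
  probability, and cannot be close to any deterministic function.

  The size of the large cluster sums is read off characteristic functions: convergence of
  \<open>\<bar>char S (t / A)\<bar> ^ G\<close> to a nondegenerate limit says that the truncated second moment
  \<open>E (min 1 (S / A)\<^sup>2)\<close> is of exact order \<open>1 / G\<close>, and since \<open>A\<close> grows faster than the square root of \<open>G\<close>,
  this forces \<open>P (\<bar>S\<bar> > A)\<close> to be of order \<open>1 / G\<close> as well.
\<close>

section \<open>Tails in the domain of attraction of a stable law\<close>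

text \<open>Passing to moduli removes the unknown centring constants, but a modulus mixes the real
  part of the characteristic function with its imaginary part. The latter is a drift bounded by the
  first moment of \<open>S\<close>, and it is negligible because
  \<open>2 ^ k / (A k)\<^sup>2\<close> tends to 0.

  The value \<open>1 + \<rho>\<close> comes from comparing two norms. When the signs align with the
  dominant sums, the bootstrap statistic is nearly their l1 norm over their l2 norm: 1 for a single
  cluster, but bounded away from 1 for two clusters whose sizes differ by a factor of at most
  \<open>R\<close>. So \<open>\<rho>\<close> depends on \<open>R\<close>, and the tolerance
  \<open>\<eta>\<close> for the squares of the remaining sums depends on \<open>\<rho>\<close>. This
  forces \<open>R\<close> to be fixed before \<open>\<eta>\<close>, which dictates the quantifiers
  of the tail estimate.

  Comparable pairs are produced by cutting \<open>2 * 2 ^ k\<close> clusters into two halves: a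
  dominant cluster in each half are independent events. The cluster sizes enter through their finite
  mean, which makes every cluster's share of the sample negligible.\<close>

lemma cmod_iexp_diff_le: "cmod (iexp a - iexp b) \<le> min 2 \<bar>a - b\<bar>"
proof -
  have "iexp a - iexp b = iexp b * (iexp (a - b) - 1)"
    by (simp add: algebra_simps flip: exp_add)
  then have "cmod (iexp a - iexp b) = cmod (iexp (a - b) - 1)" by (simp add: norm_mult)
  also have "\<dots> \<le> \<bar>a - b\<bar>" using iexp_approx1[of "a - b" 0] by simp
  finally have "cmod (iexp a - iexp b) \<le> \<bar>a - b\<bar>" .
  moreover have "cmod (iexp a - iexp b) \<le> cmod (iexp a) + cmod (iexp b)" by (rule norm_triangle_ineq4)
  ultimately show ?thesis by simp
qed

text \<open>On a Skorohod space the variables converge pointwise, and \<open>iexp\<close> is bounded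
  and 1-Lipschitz, so a single error \<open>e n\<close> serves every \<open>t\<close> of the
  interval. Uniformity matters because the upper moment bound below uses a whole range of arguments
  at the same index.\<close>

lemma weak_conv_m_char_uniform_limit:
  assumes \<mu>: "\<And>n. real_distribution (\<mu> n)" and M: "real_distribution M" and conv: "weak_conv_m \<mu> M"
  shows "uniform_limit {- \<tau>..\<tau>} (\<lambda>n. char (\<mu> n)) (char M) sequentially"
proof -
  obtain \<Omega> :: "real measure" and Ys :: "nat \<Rightarrow> real \<Rightarrow> real" and Y :: "real \<Rightarrow> real"
    where \<Omega>: "prob_space \<Omega>" and Ys[measurable]: "\<And>n. Ys n \<in> measurable \<Omega> borel"
      and dYs: "\<And>n. distr \<Omega> borel (Ys n) = \<mu> n" and Y: "Y \<in> measurable \<Omega> lborel"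
      and dY: "distr \<Omega> borel Y = M" and lim: "\<And>x. x \<in> space \<Omega> \<Longrightarrow> (\<lambda>n. Ys n x) \<longlonglongrightarrow> Y x"
    using Skorohod[OF \<mu> M conv] by blast
  interpret prob_space \<Omega> by fact
  have Y'[measurable]: "Y \<in> borel_measurable \<Omega>" using Y by simp
  define e where "e = (\<lambda>n. \<integral>x. min 2 (\<bar>\<tau>\<bar> * \<bar>Ys n x - Y x\<bar>) \<partial>\<Omega>)"
  have e0: "e \<longlonglongrightarrow> 0"
  proof -
    have "e \<longlonglongrightarrow> (\<integral>x. 0 \<partial>\<Omega>)"
      unfolding e_def
    proof (rule integral_dominated_convergence[where w = "\<lambda>_. 2"])
      show "AE x in \<Omega>. (\<lambda>n. min 2 (\<bar>\<tau>\<bar> * \<bar>Ys n x - Y x\<bar>)) \<longlonglongrightarrow> 0"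
      proof (rule AE_I2)
        fix x assume "x \<in> space \<Omega>"
        then have "(\<lambda>n. min 2 (\<bar>\<tau>\<bar> * \<bar>Ys n x - Y x\<bar>)) \<longlonglongrightarrow> min 2 (\<bar>\<tau>\<bar> * \<bar>Y x - Y x\<bar>)"
          by (intro tendsto_intros lim)
        then show "(\<lambda>n. min 2 (\<bar>\<tau>\<bar> * \<bar>Ys n x - Y x\<bar>)) \<longlonglongrightarrow> 0" by simp
      qed
    qed auto
    then show ?thesis by simp
  qed
  have bound: "cmod (char (\<mu> n) t - char M t) \<le> e n" if "t \<in> {- \<tau>..\<tau>}" for n t
  proof -
    have int: "integrable \<Omega> (\<lambda>x. iexp (t * Z x))" if [measurable]: "Z \<in> borel_measurable \<Omega>" for Z
      by (intro integrable_const_bound[of _ 1]) auto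
    have "char (\<mu> n) t - char M t = (\<integral>x. iexp (t * Ys n x) - iexp (t * Y x) \<partial>\<Omega>)"
      unfolding char_def dYs[symmetric] dY[symmetric]
      using int[OF Ys] int[OF Y'] by (simp add: integral_distr del: of_real_mult)
    also have "cmod \<dots> \<le> (\<integral>x. cmod (iexp (t * Ys n x) - iexp (t * Y x)) \<partial>\<Omega>)"
      by (rule integral_norm_bound)
    also have "\<dots> \<le> e n"
      unfolding e_def
    proof (rule integral_mono)
      show "integrable \<Omega> (\<lambda>x. cmod (iexp (t * Ys n x) - iexp (t * Y x)))"
        by (intro integrable_norm Bochner_Integration.integrable_diff int) auto
      show "integrable \<Omega> (\<lambda>x. min 2 (\<bar>\<tau>\<bar> * \<bar>Ys n x - Y x\<bar>))"
        by (intro integrable_const_bound[of _ 2]) auto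
      fix x
      have "cmod (iexp (t * Ys n x) - iexp (t * Y x)) \<le> min 2 \<bar>t * Ys n x - t * Y x\<bar>"
        by (rule cmod_iexp_diff_le)
      also have "\<dots> = min 2 (\<bar>t\<bar> * \<bar>Ys n x - Y x\<bar>)"
        by (simp add: abs_mult flip: right_diff_distrib)
      also have "\<dots> \<le> min 2 (\<bar>\<tau>\<bar> * \<bar>Ys n x - Y x\<bar>)"
        using that by (intro min.mono mult_right_mono) auto
      finally show "cmod (iexp (t * Ys n x) - iexp (t * Y x)) \<le> min 2 (\<bar>\<tau>\<bar> * \<bar>Ys n x - Y x\<bar>)" .
    qed
    finally show ?thesis .
  qed
  show ?thesis
  proof (rule uniform_limitI)
    fix \<epsilon> :: real assume "0 < \<epsilon>"
    then have "\<forall>\<^sub>F n in sequentially. e n < \<epsilon>" using e0 by (rule order_tendstoD(2)[rotated])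
    then show "\<forall>\<^sub>F n in sequentially. \<forall>t\<in>{- \<tau>..\<tau>}. dist (char (\<mu> n) t) (char M t) < \<epsilon>"
      by eventually_elim (auto simp: dist_norm intro: le_less_trans[OF bound])
  qed
qed

text \<open>If the characteristic function has modulus 1 at \<open>t\<close>, then \<open>iexp (t * x)\<close> is almost surely constant;
  doing this for all rational \<open>t\<close> at once pins \<open>x\<close> down.\<close>
lemma (in real_distribution) cmod_char_less_1:
  assumes "\<not> (\<exists>c. M = return borel c)"
  shows "\<exists>t. cmod (char M t) < 1"
proof (rule ccontr)
  assume "\<not> ?thesis"
  then have mod1: "cmod (char M t) = 1" for t
    using cmod_char_le_1[of t] by (metis less_eq_real_def)
  have AE1: "AE x in M. iexp (t * x) = char M t" for t
  proof -
    let ?z = "char M t"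
    \<comment> \<open>Multiplying by the conjugate of the mean yields a variable of modulus 1 and
      mean 1. Its real part is at most 1 with mean 1, hence equal to 1 almost surely.\<close>
    define w where "w = (\<lambda>x. cnj ?z * iexp (t * x))"
    have "integrable M (\<lambda>x. iexp (t * x))"
      by (intro integrable_const_bound[of _ 1]) auto
    then have int: "integrable M w" unfolding w_def by simp
    have "(\<integral>x. w x \<partial>M) = cnj ?z * ?z" by (simp add: w_def char_def)
    also have "\<dots> = 1" using mod1[of t] by (simp add: mult.commute complex_norm_square[symmetric])
    finally have "(\<integral>x. Re (w x) \<partial>M) = 1" using int by (simp add: integral_Re)
    then have "(\<integral>x. 1 - Re (w x) \<partial>M) = 0"
      using int by (subst Bochner_Integration.integral_diff) (auto simp: prob_space[simplified])
    moreover have norm_w: "cmod (w x) = 1" for x using mod1[of t] by (simp add: w_def norm_mult)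
    moreover have nn: "0 \<le> 1 - Re (w x)" for x
      using complex_Re_le_cmod[of "w x"] norm_w[of x] by simp
    ultimately have "AE x in M. 1 - Re (w x) = 0"
      using int by (subst (asm) integral_nonneg_eq_0_iff_AE) auto
    then show ?thesis
    proof eventually_elim
      case (elim x)
      have "Re (w x) = 1" using elim by simp
      moreover from this have "Im (w x) = 0" using norm_w[of x] by (simp add: cmod_def)
      ultimately have "w x = 1" by (simp add: complex_eq_iff)
      then have "?z * (cnj ?z * iexp (t * x)) = ?z" by (simp add: w_def)
      moreover have "?z * cnj ?z = 1" using mod1[of t] by (simp add: complex_norm_square[symmetric])
      ultimately show ?case by (metis mult.assoc mult_1)
    qed
  qed
  have "AE x in M. \<forall>t\<in>\<rat>. iexp (t * x) = char M t"
    using AE1 by (intro AE_ball_countable[THEN iffD2] countable_rat) auto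
  then obtain N where N: "N \<in> null_sets M" "\<And>x. x \<notin> N \<Longrightarrow> \<forall>t\<in>\<rat>. iexp (t * x) = char M t"
    by (auto simp: eventually_ae_filter)
  have "N \<noteq> UNIV" using N(1) prob_space by (auto simp: measure_def null_sets_def)
  then obtain c where c: "c \<notin> N" by auto
  have "x = c" if "x \<notin> N" for x
  proof (rule ccontr)
    assume "x \<noteq> c"
    then have "0 < 1 / \<bar>x - c\<bar>" by simp
    \<comment> \<open>So small a \<open>t\<close> puts \<open>t * \<bar>x - c\<bar>\<close> strictly
      between 0 and 1, where the sine is positive, whereas equal values of \<open>iexp\<close> force
      it to vanish.\<close>
    then obtain t where t: "t \<in> \<rat>" "0 < t" "t < 1 / \<bar>x - c\<bar>" using Rats_dense_in_real by blast
    have eq: "iexp (t * x) = iexp (t * c)" using N(2)[OF that] N(2)[OF c] t by auto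
    define z where "z = t * x - t * c"
    have "iexp z = iexp (t * x) * iexp (- (t * c))" by (simp add: z_def algebra_simps flip: exp_add)
    also have "\<dots> = 1" unfolding eq by (simp flip: exp_add)
    finally have "Im (iexp z) = 0" by simp
    then have "sin z = 0" by (simp add: Im_exp)
    then have "sin \<bar>z\<bar> = 0" by (simp add: abs_if)
    moreover have "\<bar>z\<bar> = t * \<bar>x - c\<bar>" using t by (simp add: z_def abs_mult flip: right_diff_distrib)
    then have "0 < \<bar>z\<bar>" "\<bar>z\<bar> < 1" using t \<open>x \<noteq> c\<close> by (auto simp: field_simps)
    then have "0 < sin \<bar>z\<bar>" using pi_gt3 by (intro sin_gt_zero) auto
    ultimately show False by simp
  qed
  then have "AE x in M. x = c" using N(1) by (intro AE_I'[of N]) auto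
  then have "distr M borel (\<lambda>x. x) = distr M borel (\<lambda>x. c)" by (intro distr_cong_AE) auto
  moreover have "distr M borel (\<lambda>x. x) = M" by (rule distr_id2) simp
  ultimately have "M = return borel c" by (simp add: distr_const)
  then show False using assms by blast
qed

section \<open>Comparison of 1 - cos with the truncated square\<close>

lemma one_minus_cos_le_abs: "1 - cos x \<le> \<bar>x\<bar>" for x :: real
proof -
  have "1 - cos x = 2 * (sin (x / 2))\<^sup>2" using cos_double_sin[of "x / 2"] by simp
  also have "\<dots> = 2 * \<bar>sin (x / 2)\<bar> * \<bar>sin (x / 2)\<bar>" by (simp add: power2_eq_square)
  also have "\<dots> \<le> 2 * \<bar>sin (x / 2)\<bar> * 1" by (intro mult_left_mono) auto
  also have "\<dots> \<le> \<bar>x\<bar>" using abs_sin_x_le_abs_x[of "x / 2"] by simp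
  finally show ?thesis .
qed

lemma one_minus_cos_le_square: "1 - cos x \<le> x\<^sup>2 / 2" for x :: real
proof -
  have "1 - cos x = 2 * \<bar>sin (x / 2)\<bar>\<^sup>2" using cos_double_sin[of "x / 2"] by simp
  also have "\<dots> \<le> 2 * \<bar>x / 2\<bar>\<^sup>2" by (intro mult_left_mono power_mono abs_sin_x_le_abs_x) auto
  also have "\<dots> = x\<^sup>2 / 2" by (simp add: power2_eq_square)
  finally show ?thesis .
qed

text \<open>The Taylor remainder of third order is at most \<open>\<bar>x\<bar> ^ 4 / 24\<close>,
  which is at most \<open>x\<^sup>2 / 6\<close> on this range; 1/3 is what remains of 1/2.\<close>

lemma one_minus_cos_ge_square:
  fixes x :: real
  assumes "\<bar>x\<bar> \<le> 2"
  shows "x\<^sup>2 / 3 \<le> 1 - cos x"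
proof -
  let ?p = "\<Sum>k\<le>3. (\<i> * complex_of_real x) ^ k / fact k"
  have "\<bar>Re (iexp x - ?p)\<bar> \<le> cmod (iexp x - ?p)" by (rule abs_Re_le_cmod)
  also have "\<dots> \<le> \<bar>x\<bar> ^ 4 / 24" using iexp_approx1[of x 3] by (simp add: fact_numeral eval_nat_numeral)
  finally have "\<bar>Re (iexp x - ?p)\<bar> \<le> \<bar>x\<bar> ^ 4 / 24" .
  moreover have "Re (iexp x - ?p) = cos x - 1 + x\<^sup>2 / 2"
    by (simp add: Re_exp eval_nat_numeral power_mult_distrib)
  moreover have "\<bar>x\<bar> ^ 4 / 24 \<le> x\<^sup>2 / 6"
  proof -
    have "\<bar>x\<bar> ^ 4 = x\<^sup>2 * \<bar>x\<bar>\<^sup>2" by (simp add: power4_eq_xxxx power2_eq_square)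
    also have "\<dots> \<le> x\<^sup>2 * 2\<^sup>2" using assms by (intro mult_left_mono power_mono) auto
    finally show ?thesis by simp
  qed
  ultimately show ?thesis by linarith
qed

lemma min_one_le_rescale:
  fixes e z :: real
  assumes "0 < e" "e \<le> 1"
  shows "min 1 z \<le> min 1 (e * z) / e"
proof (cases "e * z \<le> 1")
  case True
  then show ?thesis using assms by simp
next
  case False
  have "min 1 z \<le> 1" by simp
  also have "1 \<le> 1 / e" using assms by simp
  finally show ?thesis using False by simp
qed

text \<open>For large \<open>y\<close> the term \<open>1 - cos y\<close> alone fails, as it vanishes
  at multiples of 2 pi. Its average over \<open>u * y\<close> equals \<open>1 - sin y / y\<close>,
  which is at least 1/2 once \<open>\<bar>y\<bar> > 2\<close>. Writing the average as an integral
  over a probability measure prepares an exchange of integrals.\<close>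

lemma min_square_le_cos_average:
  fixes y :: real
  defines "U \<equiv> density lborel (indicator {0..1::real} :: real \<Rightarrow> real)"
  shows "min 1 (y\<^sup>2) \<le> 3 * (1 - cos y) + 2 * (\<integral>u. 1 - cos (u * y) \<partial>U)"
proof -
  have U: "(\<integral>u. 1 - cos (u * y) \<partial>U) = (\<integral>u. indicator {0..1} u *\<^sub>R (1 - cos (u * y)) \<partial>lborel)"
    unfolding U_def by (subst integral_density) auto
  have nn: "0 \<le> (\<integral>u. 1 - cos (u * y) \<partial>U)" by (intro Bochner_Integration.integral_nonneg) simp
  show ?thesis
  proof (cases "\<bar>y\<bar> \<le> 2")
    case True
    have "min 1 (y\<^sup>2) \<le> y\<^sup>2" by simp
    also have "\<dots> \<le> 3 * (1 - cos y)" using one_minus_cos_ge_square[OF True] by simp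
    also have "\<dots> \<le> 3 * (1 - cos y) + 2 * (\<integral>u. 1 - cos (u * y) \<partial>U)" using nn by simp
    finally show ?thesis .
  next
    case False
    then have y: "y \<noteq> 0" by auto
    have "(\<integral>u. indicator {0..1} u *\<^sub>R (1 - cos (u * y)) \<partial>lborel)
        = (1 - sin (1 * y) / y) - (0 - sin (0 * y) / y)"
      using y by (intro integral_FTC_atLeastAtMost)
        (auto intro!: derivative_eq_intros continuous_intros simp flip: has_real_derivative_iff_has_vector_derivative)
    then have eq: "(\<integral>u. 1 - cos (u * y) \<partial>U) = 1 - sin y / y" using U by simp
    have "\<bar>sin y / y\<bar> \<le> 1 / 2"
    proof -
      have "\<bar>sin y / y\<bar> = \<bar>sin y\<bar> / \<bar>y\<bar>" by simp
      also have "\<dots> \<le> 1 / 2" using False abs_sin_le_one[of y] by (intro frac_le) auto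
      finally show ?thesis .
    qed
    then have "1 \<le> 2 * (\<integral>u. 1 - cos (u * y) \<partial>U)" using eq by linarith
    moreover have "0 \<le> 3 * (1 - cos y)" by simp
    moreover have "min 1 (y\<^sup>2) \<le> 1" by simp
    ultimately show ?thesis by (smt (verit))
  qed
qed

section \<open>Truncated second moments and tails read off a characteristic function\<close>

context real_distribution
begin

text \<open>This is \<open>1 - Re (char M s)\<close>, the part of the characteristic function that
  controls truncated second moments.\<close>

definition cos_deficit :: "real \<Rightarrow> real" where
  "cos_deficit s = expectation (\<lambda>x. 1 - cos (s * x))"

lemma integrable_one_minus_cos: "integrable M (\<lambda>x. 1 - cos (s * x))"
proof (rule integrable_const_bound[of _ 2])
  have "\<bar>1 - cos (s * x)\<bar> \<le> 2" for x using cos_le_one[of "s * x"] cos_ge_minus_one[of "s * x"] by linarith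
  then show "AE x in M. norm (1 - cos (s * x)) \<le> 2" by simp
qed auto

lemma cos_deficit_nonneg: "0 \<le> cos_deficit s"
  unfolding cos_deficit_def by (intro Bochner_Integration.integral_nonneg) simp

lemma cmod_char_square: "(cmod (char M s))\<^sup>2 = (1 - cos_deficit s)\<^sup>2 + (expectation (\<lambda>x. sin (s * x)))\<^sup>2"
proof -
  have int: "integrable M (\<lambda>x. iexp (s * x))"
    by (intro integrable_const_bound[of _ 1]) auto
  have "Re (char M s) = expectation (\<lambda>x. cos (s * x))"
    unfolding char_def using int by (simp add: Re_exp flip: integral_Re)
  also have "\<dots> = expectation (\<lambda>x. 1 - (1 - cos (s * x)))" by simp
  also have "\<dots> = 1 - cos_deficit s"
    unfolding cos_deficit_def using integrable_one_minus_cos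
    by (subst Bochner_Integration.integral_diff) (auto simp: prob_space[simplified])
  finally have "Re (char M s) = 1 - cos_deficit s" .
  moreover have "Im (char M s) = expectation (\<lambda>x. sin (s * x))"
    unfolding char_def using int by (simp add: Im_exp flip: integral_Im)
  ultimately show ?thesis by (simp add: cmod_power2)
qed

lemma cos_deficit_le_abs:
  assumes "integrable M (\<lambda>x. x)"
  shows "cos_deficit s \<le> \<bar>s\<bar> * expectation (\<lambda>x. \<bar>x\<bar>)"
proof -
  have "cos_deficit s \<le> expectation (\<lambda>x. \<bar>s\<bar> * \<bar>x\<bar>)"
    unfolding cos_deficit_def
  proof (rule integral_mono[OF integrable_one_minus_cos])
    show "integrable M (\<lambda>x. \<bar>s\<bar> * \<bar>x\<bar>)" using assms by simp
    show "1 - cos (s * x) \<le> \<bar>s\<bar> * \<bar>x\<bar>" for x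
      using one_minus_cos_le_abs[of "s * x"] by (simp add: abs_mult)
  qed
  then show ?thesis by simp
qed

lemma abs_expectation_sin_le:
  assumes "integrable M (\<lambda>x. x)"
  shows "\<bar>expectation (\<lambda>x. sin (s * x))\<bar> \<le> \<bar>s\<bar> * expectation (\<lambda>x. \<bar>x\<bar>)"
proof -
  have "\<bar>expectation (\<lambda>x. sin (s * x))\<bar> \<le> expectation (\<lambda>x. \<bar>sin (s * x)\<bar>)"
    by (rule integral_abs_bound)
  also have "\<dots> \<le> expectation (\<lambda>x. \<bar>s\<bar> * \<bar>x\<bar>)"
  proof (rule integral_mono)
    show "integrable M (\<lambda>x. \<bar>sin (s * x)\<bar>)" by (intro integrable_const_bound[of _ 1]) auto
    show "integrable M (\<lambda>x. \<bar>s\<bar> * \<bar>x\<bar>)" using assms by simp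
    show "\<bar>sin (s * x)\<bar> \<le> \<bar>s\<bar> * \<bar>x\<bar>" for x
      using abs_sin_x_le_abs_x[of "s * x"] by (simp add: abs_mult)
  qed
  finally show ?thesis by simp
qed

lemma integrable_min_square: "integrable M (\<lambda>x. min 1 ((x * b)\<^sup>2))"
  by (intro integrable_const_bound[of _ 1]) auto

text \<open>Integrate the pointwise bound and exchange the integrals. The factor 5 is 3 for the
  deficit at \<open>b\<close> itself plus 2 for its average over \<open>u * b\<close>.\<close>

lemma min_square_le_cos_deficit:
  assumes D: "\<And>u. u \<in> {0..1} \<Longrightarrow> cos_deficit (u * b) \<le> D"
  shows "expectation (\<lambda>x. min 1 ((x * b)\<^sup>2)) \<le> 5 * D"
proof -
  define U where "U = density lborel (indicator {0..1::real} :: real \<Rightarrow> real)"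
  have sU[measurable_cong]: "sets U = sets borel" by (simp add: U_def)
  interpret U: prob_space U
    by standard (simp add: U_def emeasure_density ennreal_indicator)
  interpret P: pair_prob_space U M ..
  have m: "(\<lambda>(u, x). 1 - cos (u * (x * b))) \<in> borel_measurable (U \<Otimes>\<^sub>M M)"
    by measurable
  have b2: "\<bar>1 - cos z\<bar> \<le> 2" for z :: real using cos_le_one[of z] cos_ge_minus_one[of z] by linarith
  have intP: "integrable (U \<Otimes>\<^sub>M M) (\<lambda>(u, x). 1 - cos (u * (x * b)))"
    by (intro P.integrable_const_bound[of _ 2]) (use m b2 in auto)
  have intq: "integrable M (\<lambda>x. \<integral>u. 1 - cos (u * (x * b)) \<partial>U)"
    using P.integrable_snd[OF intP] by simp
  have "expectation (\<lambda>x. min 1 ((x * b)\<^sup>2))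
      \<le> expectation (\<lambda>x. 3 * (1 - cos (b * x)) + 2 * (\<integral>u. 1 - cos (u * (x * b)) \<partial>U))"
  proof (rule integral_mono)
    show "integrable M (\<lambda>x. min 1 ((x * b)\<^sup>2))" by (rule integrable_min_square)
    show "integrable M (\<lambda>x. 3 * (1 - cos (b * x)) + 2 * (\<integral>u. 1 - cos (u * (x * b)) \<partial>U))"
      using intq integrable_one_minus_cos[of b] by (intro Bochner_Integration.integrable_add integrable_mult_right) auto
    show "min 1 ((x * b)\<^sup>2) \<le> 3 * (1 - cos (b * x)) + 2 * (\<integral>u. 1 - cos (u * (x * b)) \<partial>U)" for x
      using min_square_le_cos_average[of "x * b"] by (simp add: U_def mult.commute[of b x])
  qed
  also have "\<dots> = 3 * cos_deficit b + 2 * expectation (\<lambda>x. \<integral>u. 1 - cos (u * (x * b)) \<partial>U)"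
  proof -
    have "expectation (\<lambda>x. 3 * (1 - cos (b * x)) + 2 * (\<integral>u. 1 - cos (u * (x * b)) \<partial>U))
       = expectation (\<lambda>x. 3 * (1 - cos (b * x))) + expectation (\<lambda>x. 2 * (\<integral>u. 1 - cos (u * (x * b)) \<partial>U))"
      using intq integrable_one_minus_cos[of b]
      by (intro Bochner_Integration.integral_add integrable_mult_right) auto
    then show ?thesis unfolding cos_deficit_def by (simp only: integral_mult_right_zero)
  qed
  also have "expectation (\<lambda>x. \<integral>u. 1 - cos (u * (x * b)) \<partial>U) = (\<integral>u. cos_deficit (u * b) \<partial>U)"
    using P.Fubini_integral[OF intP] by (simp add: cos_deficit_def mult_ac)
  also have "\<dots> \<le> D"
  proof -
    have "AE u in U. u \<in> {0..1}"
      unfolding U_def by (subst AE_density) (auto simp: indicator_def)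
    then have "AE u in U. cos_deficit (u * b) \<le> D" by eventually_elim (rule D)
    moreover have "(\<lambda>u. cos_deficit (u * b)) \<in> borel_measurable U" unfolding cos_deficit_def by measurable
    moreover have "integrable U (\<lambda>u. cos_deficit (u * b))"
      using P.integrable_fst[OF intP] by (simp add: cos_deficit_def mult_ac)
    ultimately have "(\<integral>u. cos_deficit (u * b) \<partial>U) \<le> (\<integral>u. D \<partial>U)" by (intro integral_mono_AE) auto
    then show ?thesis using U.prob_space by simp
  qed
  also have "cos_deficit b \<le> D" using D[of 1] by simp
  finally show ?thesis by simp
qed

text \<open>With \<open>y = 1 - (cmod (char M s))\<^sup>2\<close> and \<open>v\<close> the mean of
  the sine, the deficit \<open>h\<close> satisfies \<open>h * (2 - h) = y + v\<^sup>2\<close>. The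
  power bound gives \<open>n * y \<le> 3\<close>, the first moment gives
  \<open>n * v\<^sup>2 \<le> 1\<close>, and \<open>h \<le> 1\<close> turns the left side into an
  upper bound for \<open>h\<close>; hence 4.\<close>

lemma cos_deficit_le_of_cmod_char_power:
  assumes int: "integrable M (\<lambda>x. x)" and n: "1 \<le> n" and f: "1 / 2 \<le> cmod (char M s) ^ n"
    and s: "real n * (s * expectation (\<lambda>x. \<bar>x\<bar>))\<^sup>2 \<le> 1"
  shows "cos_deficit s \<le> 4 / real n"
proof -
  define m where "m = expectation (\<lambda>x. \<bar>x\<bar>)"
  define v where "v = expectation (\<lambda>x. sin (s * x))"
  define y where "y = 1 - (cmod (char M s))\<^sup>2"
  have m0: "0 \<le> m" unfolding m_def by (intro Bochner_Integration.integral_nonneg) simp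
  have y: "real n * y \<le> 3"
  proof -
    have "(1 / 2)\<^sup>2 \<le> (cmod (char M s) ^ n)\<^sup>2" by (intro power_mono f) simp
    also have "\<dots> = (1 - y) ^ n" by (simp add: y_def power_mult[symmetric] mult.commute)
    also have "\<dots> \<le> exp (- y) ^ n"
      using exp_ge_add_one_self[of "- y"] by (intro power_mono) (auto simp: y_def)
    also have "\<dots> = inverse (exp (real n * y))" by (simp add: exp_of_nat_mult[symmetric] exp_minus[symmetric])
    finally have "exp (real n * y) \<le> 4" by (simp add: field_simps power2_eq_square)
    then show ?thesis using exp_ge_add_one_self[of "real n * y"] by linarith
  qed
  have v: "v\<^sup>2 \<le> (s * m)\<^sup>2"
    using abs_expectation_sin_le[OF int, of s] m0
    by (simp add: v_def m_def abs_le_square_iff[symmetric] abs_mult)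
  have "(s * m)\<^sup>2 \<le> real n * (s * m)\<^sup>2" using n mult_right_mono[of 1 "real n" "(s * m)\<^sup>2"] by simp
  then have "(s * m)\<^sup>2 \<le> 1\<^sup>2" using s by (simp add: m_def)
  then have "\<bar>s * m\<bar> \<le> 1" by (simp add: abs_square_le_1)
  then have h1: "cos_deficit s \<le> 1"
    using cos_deficit_le_abs[OF int, of s] m0 by (simp add: m_def abs_mult)
  have "cos_deficit s * (2 - cos_deficit s) = y + v\<^sup>2"
    using cmod_char_square[of s] by (simp add: y_def v_def power2_eq_square algebra_simps)
  moreover have "cos_deficit s * 1 \<le> cos_deficit s * (2 - cos_deficit s)"
    using h1 cos_deficit_nonneg[of s] by (intro mult_left_mono) auto
  ultimately have "cos_deficit s \<le> y + v\<^sup>2" by simp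
  then have "real n * cos_deficit s \<le> real n * (y + (s * m)\<^sup>2)" using v by (intro mult_left_mono) auto
  also have "\<dots> \<le> 4" using y s by (simp add: m_def distrib_left)
  finally show ?thesis using n by (simp add: field_simps)
qed

text \<open>The limit has modulus near 1 around the origin, so the powers stay above 1/2 there and
  all deficits are at most \<open>4 / 2 ^ k\<close>. Averaging contributes the factor 5, and
  returning from scale \<open>\<tau> / A k\<close> to \<open>1 / A k\<close> costs
  \<open>1 / \<tau>\<^sup>2\<close>.\<close>

lemma truncated_moment_upper:
  assumes int: "integrable M (\<lambda>x. x)" and A: "\<And>k. 0 < A k" and lim: "(\<lambda>k. 2 ^ k / (A k)\<^sup>2) \<longlonglongrightarrow> 0"
    and \<mu>: "real_distribution \<mu>"
    and unif: "uniform_limit {-1..1} (\<lambda>k s. cmod (char M (s / A k)) ^ (2 ^ k)) (\<lambda>s. cmod (char \<mu> s)) sequentially"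
  shows "\<exists>C>0. \<forall>\<^sub>F k in sequentially. expectation (\<lambda>x. min 1 ((x / A k)\<^sup>2)) \<le> C / 2 ^ k"
proof -
  define m where "m = expectation (\<lambda>x. \<bar>x\<bar>)"
  interpret \<mu>: real_distribution \<mu> by fact
  obtain d where d: "0 < d" "\<And>s. \<bar>s\<bar> < d \<Longrightarrow> cmod (char \<mu> s - 1) < 1 / 4"
  proof -
    have "\<exists>d>0. \<forall>s. dist s 0 < d \<longrightarrow> dist (char \<mu> s) (char \<mu> 0) < 1 / 4"
      using \<mu>.isCont_char[of 0] unfolding continuous_at_eps_delta by (elim allE[of _ "1 / 4"]) simp
    then show ?thesis using that by (auto simp: dist_norm \<mu>.char_zero)
  qed
  \<comment> \<open>The bound 1 keeps \<open>u * \<tau>\<close> in the interval of uniform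
    convergence, and \<open>\<tau> < d\<close> keeps the modulus of the limit at least 3/4
    there.\<close>
  define \<tau> where "\<tau> = min 1 (d / 2)"
  have \<tau>: "0 < \<tau>" "\<tau> \<le> 1" "\<tau> < d" using d by (auto simp: \<tau>_def)
  have "\<forall>\<^sub>F k in sequentially. \<forall>s\<in>{-1..1}. dist (cmod (char M (s / A k)) ^ (2 ^ k)) (cmod (char \<mu> s)) < 1 / 4"
    using uniform_limitD[OF unif, of "1 / 4"] by simp
  moreover have "\<forall>\<^sub>F k in sequentially. 2 ^ k / (A k)\<^sup>2 * m\<^sup>2 < 1"
  proof -
    have "(\<lambda>k. 2 ^ k / (A k)\<^sup>2 * m\<^sup>2) \<longlonglongrightarrow> 0 * m\<^sup>2" by (intro tendsto_intros lim)
    then show ?thesis by (intro order_tendstoD(2)) auto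
  qed
  ultimately have "\<forall>\<^sub>F k in sequentially. expectation (\<lambda>x. min 1 ((x / A k)\<^sup>2)) \<le> (20 / \<tau>\<^sup>2) / 2 ^ k"
  proof eventually_elim
    case (elim k)
    have "cos_deficit (u * (\<tau> / A k)) \<le> 4 / 2 ^ k" if u: "u \<in> {0..1}" for u
    proof -
      have u\<tau>: "0 \<le> u * \<tau>" "u * \<tau> \<le> \<tau>" using u \<tau> by (auto simp: mult_left_le_one_le)
      have "cmod (1::complex) \<le> cmod (char \<mu> (u * \<tau>)) + cmod (1 - char \<mu> (u * \<tau>))"
        by (rule norm_triangle_sub)
      then have "3 / 4 \<le> cmod (char \<mu> (u * \<tau>))"
        using d(2)[of "u * \<tau>"] u\<tau> \<tau> by (simp add: norm_minus_commute)
      moreover have "dist (cmod (char M (u * \<tau> / A k)) ^ (2 ^ k)) (cmod (char \<mu> (u * \<tau>))) < 1 / 4"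
        using elim(1) u\<tau> \<tau> by (meson atLeastAtMost_iff dual_order.trans neg_le_0_iff_le zero_le_one)
      ultimately have f: "1 / 2 \<le> cmod (char M (u * \<tau> / A k)) ^ (2 ^ k)"
        unfolding dist_real_def by linarith
      have "real (2 ^ k) * (u * \<tau> / A k * m)\<^sup>2 = (u * \<tau>)\<^sup>2 * (2 ^ k / (A k)\<^sup>2 * m\<^sup>2)"
        by (simp add: power_mult_distrib power_divide)
      also have "\<dots> \<le> 1 * 1"
        using elim(2) u\<tau> \<tau> by (intro mult_mono) (simp_all add: abs_square_le_1 order.trans[OF u\<tau>(2)])
      finally have "real (2 ^ k) * (u * \<tau> / A k * m)\<^sup>2 \<le> 1" by simp
      then show ?thesis
        using cos_deficit_le_of_cmod_char_power[OF int _ f] by (simp add: m_def)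
    qed
    then have le: "expectation (\<lambda>x. min 1 ((x * (\<tau> / A k))\<^sup>2)) \<le> 5 * (4 / 2 ^ k)"
      by (rule min_square_le_cos_deficit)
    have "expectation (\<lambda>x. min 1 ((x / A k)\<^sup>2)) \<le> expectation (\<lambda>x. min 1 ((x * (\<tau> / A k))\<^sup>2) / \<tau>\<^sup>2)"
    proof (rule integral_mono)
      show "integrable M (\<lambda>x. min 1 ((x / A k)\<^sup>2))"
        using integrable_min_square[of "inverse (A k)"] by (simp add: divide_inverse)
      show "integrable M (\<lambda>x. min 1 ((x * (\<tau> / A k))\<^sup>2) / \<tau>\<^sup>2)"
        using integrable_min_square[of "\<tau> / A k"] by (rule integrable_divide)
      show "min 1 ((x / A k)\<^sup>2) \<le> min 1 ((x * (\<tau> / A k))\<^sup>2) / \<tau>\<^sup>2" for x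
      proof -
        have "(x * (\<tau> / A k))\<^sup>2 = \<tau>\<^sup>2 * (x / A k)\<^sup>2" by (simp add: power_mult_distrib power_divide)
        moreover have "0 < \<tau>\<^sup>2" "\<tau>\<^sup>2 \<le> 1" using \<tau> by (auto simp: abs_square_le_1)
        ultimately show ?thesis using min_one_le_rescale[of "\<tau>\<^sup>2" "(x / A k)\<^sup>2"] by metis
      qed
    qed
    also have "\<dots> = expectation (\<lambda>x. min 1 ((x * (\<tau> / A k))\<^sup>2)) / \<tau>\<^sup>2" by simp
    also have "\<dots> \<le> 5 * (4 / 2 ^ k) / \<tau>\<^sup>2" using le by (intro divide_right_mono) auto
    finally show ?case by (simp add: field_simps)
  qed
  then show ?thesis using \<tau> by (intro exI[of _ "20 / \<tau>\<^sup>2"]) auto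
qed

text \<open>By Bernoulli's inequality the power is at least 1 minus \<open>2 ^ k\<close> times the
  deficit. As its limit lies below 1, that product stays above half the gap, and the deficit is in
  turn bounded by the truncated moment.\<close>

lemma truncated_moment_lower:
  assumes t: "cmod (char \<mu> t) < 1"
    and lim: "(\<lambda>k. cmod (char M (t / A k)) ^ (2 ^ k)) \<longlonglongrightarrow> cmod (char \<mu> t)"
  shows "\<exists>c>0. \<forall>\<^sub>F k in sequentially. c / 2 ^ k \<le> expectation (\<lambda>x. min 1 ((x / A k)\<^sup>2))"
proof -
  define d where "d = (1 - cmod (char \<mu> t)) / 2"
  \<comment> \<open>The 2 bounds \<open>1 - cos\<close> beyond the truncation level, and
    \<open>t\<^sup>2 / 2\<close> is the quadratic coefficient below it.\<close>
  define K where "K = max 2 (t\<^sup>2 / 2)"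
  have d0: "0 < d" using t by (simp add: d_def)
  have K0: "0 < K" by (simp add: K_def)
  have "\<forall>\<^sub>F k in sequentially. cmod (char M (t / A k)) ^ (2 ^ k) < cmod (char \<mu> t) + d"
    using lim d0 by (intro order_tendstoD(2)) auto
  then have "\<forall>\<^sub>F k in sequentially. (d / K) / 2 ^ k \<le> expectation (\<lambda>x. min 1 ((x / A k)\<^sup>2))"
  proof eventually_elim
    case (elim k)
    let ?h = "cos_deficit (t / A k)" and ?f = "cmod (char M (t / A k))"
    have "1 - 2 ^ k * ?h \<le> ?f ^ (2 ^ k)"
    proof (cases "?h \<le> 1")
      case True
      have "(1 - ?h)\<^sup>2 \<le> ?f\<^sup>2" using cmod_char_square[of "t / A k"] by simp
      then have "1 - ?h \<le> ?f" by (rule power2_le_imp_le) simp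
      then have "(1 - ?h) ^ (2 ^ k) \<le> ?f ^ (2 ^ k)" using True by (intro power_mono) auto
      moreover have "1 + real (2 ^ k) * (- ?h) \<le> (1 + (- ?h)) ^ (2 ^ k)"
        using True by (intro Bernoulli_inequality) auto
      ultimately show ?thesis by simp
    next
      case False
      have "1 * ?h \<le> 2 ^ k * ?h" using False by (intro mult_right_mono) auto
      moreover have "0 \<le> ?f ^ (2 ^ k)" by simp
      ultimately show ?thesis using False by linarith
    qed
    then have "d \<le> 2 ^ k * ?h" using elim unfolding d_def by (simp add: field_simps)
    moreover have "?h \<le> K * expectation (\<lambda>x. min 1 ((x / A k)\<^sup>2))"
    proof -
      have "?h \<le> expectation (\<lambda>x. K * min 1 ((x / A k)\<^sup>2))"
        unfolding cos_deficit_def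
      proof (rule integral_mono[OF integrable_one_minus_cos])
        show "integrable M (\<lambda>x. K * min 1 ((x / A k)\<^sup>2))"
          using integrable_min_square[of "inverse (A k)"] by (simp add: divide_inverse)
        show "1 - cos (t / A k * x) \<le> K * min 1 ((x / A k)\<^sup>2)" for x
        proof (cases "1 \<le> (x / A k)\<^sup>2")
          case True
          then have "K * min 1 ((x / A k)\<^sup>2) = K" by simp
          moreover have "2 \<le> K" by (simp add: K_def)
          ultimately show ?thesis using cos_ge_minus_one[of "t / A k * x"] by linarith
        next
          case False
          have "1 - cos (t / A k * x) \<le> (t / A k * x)\<^sup>2 / 2" by (rule one_minus_cos_le_square)
          also have "\<dots> = (t\<^sup>2 / 2) * (x / A k)\<^sup>2" by (simp add: power_mult_distrib power_divide)
          also have "\<dots> \<le> K * (x / A k)\<^sup>2" by (intro mult_right_mono) (auto simp: K_def)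
          finally show ?thesis using False by (simp add: min_def)
        qed
      qed
      then show ?thesis by simp
    qed
    ultimately have "d \<le> 2 ^ k * (K * expectation (\<lambda>x. min 1 ((x / A k)\<^sup>2)))"
      by (meson mult_left_mono order_trans zero_le_numeral zero_le_power)
    then show ?case using K0 by (simp add: field_simps)
  qed
  then show ?thesis using d0 K0 by (intro exI[of _ "d / K"]) auto
qed

text \<open>Since the norming constants grow faster than the square root of the sample size, the part
  of the truncated second moment at level \<open>A (k + j)\<close> that comes from \<open>\<bar>x\<bar> \<le> A k\<close> is too small to
  account for the lower bound; the rest has to come from the tail.\<close>
lemma tail_lower:
  assumes A: "\<And>k. 0 < A k" and ratio: "\<And>j. (\<lambda>k. A (k + j) / A k) \<longlonglongrightarrow> \<beta> ^ j" and \<beta>: "1 < \<beta>" "2 < \<beta>\<^sup>2"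
    and c: "0 < c" "\<forall>\<^sub>F k in sequentially. c / 2 ^ k \<le> expectation (\<lambda>x. min 1 ((x / A k)\<^sup>2))"
    and C: "0 < C" "\<forall>\<^sub>F k in sequentially. expectation (\<lambda>x. min 1 ((x / A k)\<^sup>2)) \<le> C / 2 ^ k"
  shows "\<exists>p>0. \<forall>\<^sub>F k in sequentially. p / 2 ^ k \<le> prob {x. A k < \<bar>x\<bar>}"
proof -
  define U where "U = (\<lambda>k. expectation (\<lambda>x. min 1 ((x / A k)\<^sup>2)))"
  have "(\<lambda>j. (2 / \<beta>\<^sup>2) ^ j) \<longlonglongrightarrow> 0" using \<beta> by (intro LIMSEQ_realpow_zero) auto
  then have "\<forall>\<^sub>F j in sequentially. (2 / \<beta>\<^sup>2) ^ j < c / C" using c C by (intro order_tendstoD(2)) auto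
  \<comment> \<open>Going up \<open>j\<close> levels costs \<open>2 ^ j\<close> in the lower bound,
    while the share of \<open>\<bar>x\<bar> \<le> A k\<close> shrinks by about
    \<open>\<beta> ^ (2 * j)\<close>. Since \<open>\<beta>\<^sup>2 > 2\<close>, some
    \<open>j\<close> lets the lower bound win, leaving the margin \<open>q0 > 0\<close>.\<close>
  then obtain j where j: "(2 / \<beta>\<^sup>2) ^ j < c / C" by (auto simp: eventually_sequentially)
  define q where "q = (\<lambda>k. c / 2 ^ j - C / (A (k + j) / A k)\<^sup>2)"
  define q0 where "q0 = c / 2 ^ j - C / (\<beta> ^ j)\<^sup>2"
  have q: "q \<longlonglongrightarrow> q0"
    unfolding q_def q0_def using \<beta> by (intro tendsto_intros ratio) auto
  have "C * (2 / \<beta>\<^sup>2) ^ j < c" using j C by (simp add: field_simps)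
  then have q0: "0 < q0" unfolding q0_def using \<beta> by (simp add: field_simps power_mult_distrib power_divide power_mult[symmetric] mult.commute)
  \<comment> \<open>Multiplied by the squared level, the truncated square is the minimum of
    \<open>x\<^sup>2\<close> and that squared level. Where \<open>\<bar>x\<bar> \<le> A k\<close>
    the difference of the two levels is therefore at most 0.\<close>
  have key: "(A (k + j))\<^sup>2 * U (k + j) - (A k)\<^sup>2 * U k \<le> (A (k + j))\<^sup>2 * prob {x. A k < \<bar>x\<bar>}" for k
  proof -
    have sq: "a\<^sup>2 * min 1 ((x / a)\<^sup>2) = min (a\<^sup>2) (x\<^sup>2)" if "0 < a" for a x :: real
      using that by (auto simp: min_def power_divide field_simps)
    have im: "integrable M (\<lambda>x. min 1 ((x / A i)\<^sup>2))" for i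
      using integrable_min_square[of "inverse (A i)"] by (simp add: divide_inverse)
    have "(A (k + j))\<^sup>2 * U (k + j) - (A k)\<^sup>2 * U k
        = expectation (\<lambda>x. (A (k + j))\<^sup>2 * min 1 ((x / A (k + j))\<^sup>2) - (A k)\<^sup>2 * min 1 ((x / A k)\<^sup>2))"
      unfolding U_def using im by (subst Bochner_Integration.integral_diff) auto
    also have "\<dots> \<le> expectation (\<lambda>x. (A (k + j))\<^sup>2 * indicator {x. A k < \<bar>x\<bar>} x)"
    proof (rule integral_mono)
      show "integrable M (\<lambda>x. (A (k + j))\<^sup>2 * min 1 ((x / A (k + j))\<^sup>2) - (A k)\<^sup>2 * min 1 ((x / A k)\<^sup>2))"
        using im by (intro Bochner_Integration.integrable_diff integrable_mult_right) auto
      show "integrable M (\<lambda>x. (A (k + j))\<^sup>2 * indicator {x. A k < \<bar>x\<bar>} x)"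
        by (intro integrable_mult_right integrable_real_indicator) (auto simp: emeasure_eq_measure)
      show "(A (k + j))\<^sup>2 * min 1 ((x / A (k + j))\<^sup>2) - (A k)\<^sup>2 * min 1 ((x / A k)\<^sup>2)
          \<le> (A (k + j))\<^sup>2 * indicator {x. A k < \<bar>x\<bar>} x" for x
      proof (cases "A k < \<bar>x\<bar>")
        case True
        have "(A (k + j))\<^sup>2 * min 1 ((x / A (k + j))\<^sup>2) - (A k)\<^sup>2 * min 1 ((x / A k)\<^sup>2)
            \<le> (A (k + j))\<^sup>2 * 1 - 0"
          by (intro diff_mono mult_left_mono mult_nonneg_nonneg) auto
        then show ?thesis using True by simp
      next
        case False
        then have "x\<^sup>2 \<le> (A k)\<^sup>2" by (simp add: abs_le_square_iff[symmetric])
        then show ?thesis using False sq[OF A] by simp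
      qed
    qed
    also have "\<dots> = (A (k + j))\<^sup>2 * prob {x. A k < \<bar>x\<bar>}" by simp
    finally show ?thesis .
  qed
  have "\<forall>\<^sub>F k in sequentially. q0 / 2 < q k" using q q0 by (intro order_tendstoD(1)) auto
  moreover have "\<forall>\<^sub>F k in sequentially. c / 2 ^ (k + j) \<le> U (k + j)"
    using c(2) by (subst eventually_sequentially_seg) (simp add: U_def)
  moreover have "\<forall>\<^sub>F k in sequentially. U k \<le> C / 2 ^ k" using C(2) by (simp add: U_def)
  ultimately have "\<forall>\<^sub>F k in sequentially. (q0 / 2) / 2 ^ k \<le> prob {x. A k < \<bar>x\<bar>}"
  proof eventually_elim
    case (elim k)
    have Aj: "0 < (A (k + j))\<^sup>2" using A[of "k + j"] by simp
    have "(A (k + j))\<^sup>2 * (c / 2 ^ (k + j)) - (A k)\<^sup>2 * (C / 2 ^ k)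
        \<le> (A (k + j))\<^sup>2 * U (k + j) - (A k)\<^sup>2 * U k"
      using elim by (intro diff_mono mult_left_mono) auto
    also have "\<dots> \<le> (A (k + j))\<^sup>2 * prob {x. A k < \<bar>x\<bar>}" by (rule key)
    finally have "(A (k + j))\<^sup>2 * (c / 2 ^ (k + j)) - (A k)\<^sup>2 * (C / 2 ^ k)
      \<le> (A (k + j))\<^sup>2 * prob {x. A k < \<bar>x\<bar>}" .
    moreover have "(A (k + j))\<^sup>2 * (c / 2 ^ (k + j)) - (A k)\<^sup>2 * (C / 2 ^ k) = (A (k + j))\<^sup>2 * (q k / 2 ^ k)"
      using A[of k] A[of "k + j"] by (simp add: q_def power_divide power_add field_simps)
    ultimately have "(A (k + j))\<^sup>2 * (q k / 2 ^ k) \<le> (A (k + j))\<^sup>2 * prob {x. A k < \<bar>x\<bar>}" by linarith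
    then have "q k / 2 ^ k \<le> prob {x. A k < \<bar>x\<bar>}" using Aj by (rule mult_left_le_imp_le)
    moreover have "(q0 / 2) / 2 ^ k \<le> q k / 2 ^ k" using elim by (intro divide_right_mono) auto
    ultimately show ?case by linarith
  qed
  then show ?thesis using q0 by (intro exI[of _ "q0 / 2"]) auto
qed

text \<open>The upper moment bound also bounds the tail at a higher level, so capping the sizes at
  \<open>R\<close> times the lower level keeps half of the tail mass. Raising the level with the
  sample size fixed then makes the rest as small as \<open>\<eta>\<close> demands, at the expense of
  \<open>p\<close> only. That \<open>R\<close> does not depend on \<open>\<eta>\<close> is
  essential, because \<open>\<eta>\<close> will be chosen in terms of \<open>R\<close>.\<close>

lemma tail_window:
  assumes A: "\<And>k. 0 < A k" and ratio: "\<And>j. (\<lambda>k. A (k + j) / A k) \<longlonglongrightarrow> \<beta> ^ j" and \<beta>: "1 < \<beta>"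
    and p: "0 < p" "\<forall>\<^sub>F k in sequentially. p / 2 ^ k \<le> prob {x. A k < \<bar>x\<bar>}"
    and C: "0 < C" "\<forall>\<^sub>F k in sequentially. expectation (\<lambda>x. min 1 ((x / A k)\<^sup>2)) \<le> C / 2 ^ k"
  shows "\<exists>R\<ge>1. \<forall>\<eta>. 0 < \<eta> \<and> \<eta> \<le> 1 \<longrightarrow> (\<exists>p>0. \<exists>a. \<forall>\<^sub>F k in sequentially. 0 < a k \<and>
     p \<le> 2 ^ k * prob {x. a k < \<bar>x\<bar> \<and> \<bar>x\<bar> \<le> R * a k} \<and>
     2 ^ k * expectation (\<lambda>x. min 1 (x\<^sup>2 / (\<eta> * (a k)\<^sup>2))) \<le> 1 / 2)"
proof -
  have half: "\<exists>i. B / 2 ^ i \<le> e" if "0 < B" "0 < e" for B e :: real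
  proof -
    obtain i where "B / e < 2 ^ i" using real_arch_pow[of 2 "B / e"] by auto
    then show ?thesis using that by (intro exI[of _ i]) (simp add: field_simps)
  qed
  have im: "integrable M (\<lambda>x. min 1 ((x / A i)\<^sup>2))" for i
    using integrable_min_square[of "inverse (A i)"] by (simp add: divide_inverse)
  \<comment> \<open>With this \<open>i\<close> the mass above \<open>A (k + i)\<close> uses up at
    most half of \<open>p / 2 ^ k\<close>. The ratio \<open>A (k + i) / A k\<close> tends to
    \<open>\<beta> ^ i\<close>, so the factor 2 in \<open>R\<close> makes \<open>R * A k\<close>
    eventually exceed \<open>A (k + i)\<close>.\<close>
  obtain i where i: "C / 2 ^ i \<le> p / 2" using half[OF C(1), of "p / 2"] p by auto
  define R where "R = 2 * \<beta> ^ i"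
  have \<beta>i: "1 \<le> \<beta> ^ i" using \<beta> by simp
  have R1: "1 \<le> R" using \<beta>i by (simp add: R_def)
  have "\<forall>\<^sub>F k in sequentially. A (k + i) / A k < R"
    using ratio[of i] \<beta>i by (intro order_tendstoD(2)) (auto simp: R_def)
  moreover have "\<forall>\<^sub>F k in sequentially. expectation (\<lambda>x. min 1 ((x / A (k + i))\<^sup>2)) \<le> C / 2 ^ (k + i)"
    using C(2) by (subst eventually_sequentially_seg)
  ultimately have win: "\<forall>\<^sub>F k in sequentially. (p / 2) / 2 ^ k \<le> prob {x. A k < \<bar>x\<bar> \<and> \<bar>x\<bar> \<le> R * A k}"
    using p(2)
  proof eventually_elim
    case (elim k)
    have "prob {x. R * A k < \<bar>x\<bar>} = expectation (indicator {x. R * A k < \<bar>x\<bar>})" by simp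
    also have "\<dots> \<le> expectation (\<lambda>x. min 1 ((x / A (k + i))\<^sup>2))"
    proof (rule integral_mono[OF _ im])
      show "integrable M (indicat_real {x. R * A k < \<bar>x\<bar>})"
        by (intro integrable_real_indicator) (auto simp: emeasure_eq_measure)
      show "indicat_real {x. R * A k < \<bar>x\<bar>} x \<le> min 1 ((x / A (k + i))\<^sup>2)" for x
      proof (cases "R * A k < \<bar>x\<bar>")
        case True
        have "A (k + i) < R * A k" using elim(1) A[of k] by (simp add: field_simps)
        then have "\<bar>A (k + i)\<bar> \<le> \<bar>x\<bar>" using True A[of "k + i"] by simp
        then have "(A (k + i))\<^sup>2 \<le> x\<^sup>2" by (simp only: abs_le_square_iff)
        then show ?thesis using A[of "k + i"] by (simp add: power_divide indicator_le_1)
      qed simp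
    qed
    also have "\<dots> \<le> (C / 2 ^ i) / 2 ^ k" using elim(2) by (simp add: power_add field_simps)
    also have "\<dots> \<le> (p / 2) / 2 ^ k" using i by (intro divide_right_mono) auto
    finally have tail: "prob {x. R * A k < \<bar>x\<bar>} \<le> (p / 2) / 2 ^ k" .
    have "p / 2 ^ k \<le> prob {x. A k < \<bar>x\<bar>}" by (rule elim(3))
    also have "\<dots> \<le> prob ({x. A k < \<bar>x\<bar> \<and> \<bar>x\<bar> \<le> R * A k} \<union> {x. R * A k < \<bar>x\<bar>})"
      by (intro finite_measure_mono) auto
    also have "\<dots> \<le> prob {x. A k < \<bar>x\<bar> \<and> \<bar>x\<bar> \<le> R * A k} + prob {x. R * A k < \<bar>x\<bar>}"
      by (intro measure_Un_le) auto
    finally show ?case using tail by (simp add: field_simps)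
  qed
  show ?thesis
  proof (rule exI[of _ R], intro conjI R1 allI impI)
    fix \<eta> :: real assume \<eta>: "0 < \<eta> \<and> \<eta> \<le> 1"
    obtain j where j: "(C / \<eta>) / 2 ^ j \<le> 1 / 2" using half[of "C / \<eta>" "1 / 2"] C \<eta> by auto
    \<comment> \<open>The level belongs to sample size \<open>2 ^ (k + j)\<close> while only
      \<open>2 ^ k\<close> clusters are drawn, which gains the factor \<open>2 ^ j\<close> in the
      moment and loses it in the window probability.\<close>
    define a where "a = (\<lambda>k. A (k + j))"
    define p' where "p' = (p / 2) / 2 ^ j"
    have "\<forall>\<^sub>F k in sequentially. expectation (\<lambda>x. min 1 ((x / A (k + j))\<^sup>2)) \<le> C / 2 ^ (k + j)"
      using C(2) by (subst eventually_sequentially_seg)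
    moreover have "\<forall>\<^sub>F k in sequentially. (p / 2) / 2 ^ (k + j) \<le> prob {x. A (k + j) < \<bar>x\<bar> \<and> \<bar>x\<bar> \<le> R * A (k + j)}"
      using win by (subst eventually_sequentially_seg)
    ultimately have "\<forall>\<^sub>F k in sequentially. 0 < a k \<and>
     p' \<le> 2 ^ k * prob {x. a k < \<bar>x\<bar> \<and> \<bar>x\<bar> \<le> R * a k} \<and>
     2 ^ k * expectation (\<lambda>x. min 1 (x\<^sup>2 / (\<eta> * (a k)\<^sup>2))) \<le> 1 / 2"
    proof eventually_elim
      case (elim k)
      have "expectation (\<lambda>x. min 1 (x\<^sup>2 / (\<eta> * (a k)\<^sup>2))) \<le> expectation (\<lambda>x. min 1 ((x / a k)\<^sup>2) / \<eta>)"
      proof (rule integral_mono)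
        show "integrable M (\<lambda>x. min 1 (x\<^sup>2 / (\<eta> * (a k)\<^sup>2)))"
          using \<eta> by (intro integrable_const_bound[of _ 1]) auto
        show "integrable M (\<lambda>x. min 1 ((x / a k)\<^sup>2) / \<eta>)" unfolding a_def by (intro integrable_divide im)
        show "min 1 (x\<^sup>2 / (\<eta> * (a k)\<^sup>2)) \<le> min 1 ((x / a k)\<^sup>2) / \<eta>" for x
        proof -
          have "x\<^sup>2 / (\<eta> * (a k)\<^sup>2) = (x / a k)\<^sup>2 / \<eta>" by (simp add: power_divide)
          moreover have "1 \<le> 1 / \<eta>" using \<eta> by simp
          ultimately show ?thesis using \<eta> by (auto simp: min_def divide_le_cancel)
        qed
      qed
      also have "\<dots> = expectation (\<lambda>x. min 1 ((x / a k)\<^sup>2)) / \<eta>" by simp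
      also have "\<dots> \<le> C / 2 ^ (k + j) / \<eta>" using elim(1) \<eta> by (intro divide_right_mono) (auto simp: a_def)
      also have "\<dots> = ((C / \<eta>) / 2 ^ j) / 2 ^ k" by (simp add: power_add field_simps)
      also have "\<dots> \<le> (1 / 2) / 2 ^ k" using j by (intro divide_right_mono) auto
      finally have "2 ^ k * expectation (\<lambda>x. min 1 (x\<^sup>2 / (\<eta> * (a k)\<^sup>2))) \<le> 1 / 2"
        by (simp add: field_simps)
      moreover have "p' \<le> 2 ^ k * prob {x. a k < \<bar>x\<bar> \<and> \<bar>x\<bar> \<le> R * a k}"
        using elim(2) by (simp add: p'_def a_def power_add field_simps)
      ultimately show ?case using A by (simp add: a_def)
    qed
    moreover have "0 < p'" using p by (simp add: p'_def)
    ultimately show "\<exists>p>0. \<exists>a. \<forall>\<^sub>F k in sequentially. 0 < a k \<and>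
     p \<le> 2 ^ k * prob {x. a k < \<bar>x\<bar> \<and> \<bar>x\<bar> \<le> R * a k} \<and>
     2 ^ k * expectation (\<lambda>x. min 1 (x\<^sup>2 / (\<eta> * (a k)\<^sup>2))) \<le> 1 / 2" by blast
  qed
qed

end

section \<open>Norming constants and sums along powers of two\<close>

lemma slowly_varying_dyadic_ratio:
  assumes L: "slowly_varying L" and A: "\<And>G. 1 \<le> G \<Longrightarrow> 0 < A G \<and> A G = real G powr (1 / \<alpha>) * L (real G)"
  shows "(\<lambda>k. A (2 ^ (k + j)) / A (2 ^ k)) \<longlonglongrightarrow> (2 powr (1 / \<alpha>)) ^ j"
proof -
  have pos: "0 < A (2 ^ k)" for k by (rule conjunct1[OF A]) simp
  have one: "(\<lambda>k. A (2 ^ Suc k) / A (2 ^ k)) \<longlonglongrightarrow> 2 powr (1 / \<alpha>)"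
  proof -
    have "((\<lambda>x. L (2 * x) / L x) \<longlongrightarrow> 1) at_top" using L by (simp add: slowly_varying_def)
    moreover have "filterlim (\<lambda>k. (2::real) ^ k) at_top sequentially"
      using filterlim_compose[OF filterlim_real_sequentially filterlim_subseq[of "\<lambda>k. 2 ^ k"]]
      by (simp add: strict_mono_def)
    ultimately have "(\<lambda>k. L (2 * 2 ^ k) / L (2 ^ k)) \<longlonglongrightarrow> 1" by (rule filterlim_compose)
    then have "(\<lambda>k. 2 powr (1 / \<alpha>) * (L (2 * 2 ^ k) / L (2 ^ k))) \<longlonglongrightarrow> 2 powr (1 / \<alpha>) * 1"
      by (intro tendsto_intros)
    moreover have "2 powr (1 / \<alpha>) * (L (2 * 2 ^ k) / L (2 ^ k)) = A (2 ^ Suc k) / A (2 ^ k)" for k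
      using A[of "2 ^ Suc k"] A[of "2 ^ k"] by (simp add: powr_mult)
    ultimately show ?thesis by simp
  qed
  show ?thesis
  proof (induction j)
    case 0
    show ?case using pos by (simp add: less_imp_neq[symmetric])
  next
    case (Suc j)
    have "(\<lambda>k. A (2 ^ Suc (k + j)) / A (2 ^ (k + j))) \<longlonglongrightarrow> 2 powr (1 / \<alpha>)"
      using LIMSEQ_ignore_initial_segment[OF one, of j] by simp
    then have "(\<lambda>k. A (2 ^ Suc (k + j)) / A (2 ^ (k + j)) * (A (2 ^ (k + j)) / A (2 ^ k)))
        \<longlonglongrightarrow> 2 powr (1 / \<alpha>) * (2 powr (1 / \<alpha>)) ^ j" by (intro tendsto_mult Suc.IH)
    then show ?case using pos by (simp add: less_imp_neq[symmetric])
  qed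
qed

text \<open>Quotients of consecutive terms tend to \<open>2 / \<beta>\<^sup>2 < 1\<close>, so the
  ratio test even gives summability; \<open>r\<close> is the midpoint between this limit and
  1.\<close>

lemma dyadic_growth:
  fixes A :: "nat \<Rightarrow> real"
  assumes A: "\<And>k. 0 < A k" and ratio: "(\<lambda>k. A (Suc k) / A k) \<longlonglongrightarrow> \<beta>" and \<beta>: "2 < \<beta>\<^sup>2"
  shows "(\<lambda>k. 2 ^ k / (A k)\<^sup>2) \<longlonglongrightarrow> 0"
proof -
  define r where "r = (2 / \<beta>\<^sup>2 + 1) / 2"
  have "2 / \<beta>\<^sup>2 < 1" using \<beta> by (subst divide_less_eq_1_pos) auto
  then have r: "2 / \<beta>\<^sup>2 < r" "r < 1" by (auto simp: r_def)
  have "(\<lambda>k. 2 / (A (Suc k) / A k)\<^sup>2) \<longlonglongrightarrow> 2 / \<beta>\<^sup>2" using \<beta> by (intro tendsto_intros ratio) auto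
  then have "\<forall>\<^sub>F k in sequentially. 2 / (A (Suc k) / A k)\<^sup>2 < r" using r by (intro order_tendstoD(2)) auto
  then obtain K where K: "\<And>k. K \<le> k \<Longrightarrow> 2 / (A (Suc k) / A k)\<^sup>2 < r"
    by (auto simp: eventually_sequentially)
  have "summable (\<lambda>k. 2 ^ k / (A k)\<^sup>2)"
  proof (rule summable_ratio_test[OF r(2), of K])
    fix k assume "K \<le> k"
    have "2 ^ Suc k / (A (Suc k))\<^sup>2 = 2 / (A (Suc k) / A k)\<^sup>2 * (2 ^ k / (A k)\<^sup>2)"
      using A[of k] A[of "Suc k"] by (simp add: power_divide)
    also have "\<dots> \<le> r * (2 ^ k / (A k)\<^sup>2)" using K[OF \<open>K \<le> k\<close>] by (intro mult_right_mono) auto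
    finally show "norm (2 ^ Suc k / (A (Suc k))\<^sup>2) \<le> r * norm (2 ^ k / (A k)\<^sup>2)" by simp
  qed
  then show ?thesis by (rule summable_LIMSEQ_zero)
qed

text \<open>The centring \<open>D\<close> contributes only a factor of modulus 1, so nothing about
  its size has to be known.\<close>

lemma (in prob_space) cmod_char_iid_sum:
  assumes indep: "indep_vars (\<lambda>_. borel) X UNIV"
    and ident: "\<And>g. distr M borel (X g) = \<nu>"
  shows "cmod (char (distr M borel (\<lambda>\<omega>. ((\<Sum>g<G. X g \<omega>) - D) / A)) t) = cmod (char \<nu> (t / A)) ^ G"
proof -
  have X[measurable]: "X g \<in> borel_measurable M" for g using indep by (simp add: indep_vars_def)
  define Z where "Z = (\<lambda>\<omega>. \<Sum>g<G. X g \<omega>)"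
  have Z[measurable]: "Z \<in> borel_measurable M" unfolding Z_def by measurable
  have "char (distr M borel (\<lambda>\<omega>. (Z \<omega> - D) / A)) t = (\<integral>\<omega>. iexp (t * ((Z \<omega> - D) / A)) \<partial>M)"
    unfolding char_def by (subst integral_distr) auto
  also have "\<dots> = (\<integral>\<omega>. iexp (- (t * D / A)) * iexp (t / A * Z \<omega>) \<partial>M)"
    by (simp add: diff_divide_distrib right_diff_distrib flip: exp_add)
  also have "\<dots> = iexp (- (t * D / A)) * char (distr M borel Z) (t / A)"
    unfolding char_def by (subst integral_distr) auto
  also have "char (distr M borel Z) (t / A) = (\<Prod>g<G. char (distr M borel (X g)) (t / A))"
    unfolding Z_def by (rule char_distr_sum) (rule indep_vars_subset[OF indep], simp)
  also have "\<dots> = char \<nu> (t / A) ^ G" by (simp add: ident)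
  finally have "cmod (char (distr M borel (\<lambda>\<omega>. (Z \<omega> - D) / A)) t)
      = cmod (iexp (- (t * D / A))) * cmod (char \<nu> (t / A)) ^ G" by (simp only: norm_mult norm_power)
  then show ?thesis by (simp add: Z_def)
qed

lemma (in prob_space) stable_DoA_tail_window:
  assumes indep: "indep_vars (\<lambda>_. borel) X UNIV"
    and ident: "\<And>g. distr M borel (X g) = \<nu>"
    and int: "integrable M (X 0)" and \<alpha>: "0 < \<alpha>" "\<alpha> < 2" and doa: "stable_DoA M X \<alpha>"
  shows "\<exists>R\<ge>1. \<forall>\<eta>. 0 < \<eta> \<and> \<eta> \<le> 1 \<longrightarrow> (\<exists>p>0. \<exists>a. \<forall>\<^sub>F k in sequentially. 0 < a k \<and>
     p \<le> 2 ^ k * measure \<nu> {x. a k < \<bar>x\<bar> \<and> \<bar>x\<bar> \<le> R * a k} \<and>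
     2 ^ k * (\<integral>x. min 1 (x\<^sup>2 / (\<eta> * (a k)\<^sup>2)) \<partial>\<nu>) \<le> 1 / 2)"
proof -
  have X[measurable]: "X g \<in> borel_measurable M" for g using indep by (simp add: indep_vars_def)
  interpret \<nu>: real_distribution \<nu> unfolding ident[of 0, symmetric] by (rule real_distribution_distr) simp
  have int\<nu>: "integrable \<nu> (\<lambda>x. x)" unfolding ident[of 0, symmetric] using int by (subst integrable_distr_eq) auto
  obtain A D L \<mu> where L: "slowly_varying L" and A: "\<And>G. 1 \<le> G \<Longrightarrow> 0 < A G \<and> A G = real G powr (1 / \<alpha>) * L (real G)"
    and \<mu>: "real_distribution \<mu>" and nondeg: "\<not> (\<exists>c. \<mu> = return borel c)"
    and conv: "weak_conv_m (\<lambda>G. distr M borel (\<lambda>\<omega>. ((\<Sum>g<G. X g \<omega>) - D G) / A G)) \<mu>"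
    using doa unfolding stable_DoA_def by blast
  interpret \<mu>: real_distribution \<mu> by fact
  define B where "B = (\<lambda>k. A (2 ^ k))"
  define \<beta> where "\<beta> = 2 powr (1 / \<alpha>)"
  define \<mu>s where "\<mu>s = (\<lambda>k. distr M borel (\<lambda>\<omega>. ((\<Sum>g<2 ^ k. X g \<omega>) - D (2 ^ k)) / A (2 ^ k)))"
  have B: "0 < B k" for k using A[of "2 ^ k"] by (simp add: B_def)
  have ratio: "(\<lambda>k. B (k + j) / B k) \<longlonglongrightarrow> \<beta> ^ j" for j
    unfolding B_def \<beta>_def by (rule slowly_varying_dyadic_ratio[OF L A])
  \<comment> \<open>Here \<open>\<alpha> < 2\<close> enters: it makes the norming constants outgrow
    the square root of the sample size.\<close>
  have "(2::real) powr (2 * (1 / 2)) < 2 powr (2 * (1 / \<alpha>))" using \<alpha> by (intro powr_less_mono) (auto simp: field_simps)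
  then have \<beta>2: "2 < \<beta>\<^sup>2" unfolding \<beta>_def by (simp add: powr_power)
  have \<beta>1: "1 < \<beta>" unfolding \<beta>_def using \<alpha> by (intro gr_one_powr) auto
  have growth: "(\<lambda>k. 2 ^ k / (B k)\<^sup>2) \<longlonglongrightarrow> 0"
    using ratio[of 1] by (intro dyadic_growth[OF B _ \<beta>2]) simp
  have \<mu>s: "real_distribution (\<mu>s k)" for k
    unfolding \<mu>s_def by (rule real_distribution_distr) simp
  have sub: "filterlim (\<lambda>k. (2::nat) ^ k) sequentially sequentially"
    by (intro filterlim_subseq) (simp add: strict_mono_def)
  have conv': "weak_conv_m \<mu>s \<mu>"
    unfolding weak_conv_m_def weak_conv_def \<mu>s_def
  proof (intro allI impI)
    fix x assume "isCont (cdf \<mu>) x"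
    then have "(\<lambda>G. cdf (distr M borel (\<lambda>\<omega>. ((\<Sum>g<G. X g \<omega>) - D G) / A G)) x) \<longlonglongrightarrow> cdf \<mu> x"
      using conv by (simp add: weak_conv_m_def weak_conv_def)
    then show "(\<lambda>k. cdf (distr M borel (\<lambda>\<omega>. ((\<Sum>g<2 ^ k. X g \<omega>) - D (2 ^ k)) / A (2 ^ k))) x) \<longlonglongrightarrow> cdf \<mu> x"
      by (rule filterlim_compose[OF _ sub])
  qed
  have mod: "cmod (char (\<mu>s k) t) = cmod (char \<nu> (t / B k)) ^ (2 ^ k)" for k t
    unfolding \<mu>s_def B_def by (rule cmod_char_iid_sum[OF indep ident])
  have "uniform_limit {-1..1} (\<lambda>k s. cmod (char (\<mu>s k) s)) (\<lambda>s. cmod (char \<mu> s)) sequentially"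
    by (intro uniform_limit_norm weak_conv_m_char_uniform_limit[OF \<mu>s \<mu> conv', of 1])
  then have "uniform_limit {-1..1} (\<lambda>k s. cmod (char \<nu> (s / B k)) ^ (2 ^ k)) (\<lambda>s. cmod (char \<mu> s)) sequentially"
    unfolding mod .
  then obtain C where C: "0 < C" "\<forall>\<^sub>F k in sequentially. \<nu>.expectation (\<lambda>x. min 1 ((x / B k)\<^sup>2)) \<le> C / 2 ^ k"
    using \<nu>.truncated_moment_upper[OF int\<nu> B growth \<mu>] by blast
  obtain t where t: "cmod (char \<mu> t) < 1" using \<mu>.cmod_char_less_1[OF nondeg] by blast
  have "(\<lambda>k. cmod (char (\<mu>s k) t)) \<longlonglongrightarrow> cmod (char \<mu> t)"
    by (intro tendsto_norm levy_continuity1[OF \<mu>s \<mu> conv'])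
  then obtain c where c: "0 < c" "\<forall>\<^sub>F k in sequentially. c / 2 ^ k \<le> \<nu>.expectation (\<lambda>x. min 1 ((x / B k)\<^sup>2))"
    using \<nu>.truncated_moment_lower[OF t] unfolding mod by blast
  obtain p where p: "0 < p" "\<forall>\<^sub>F k in sequentially. p / 2 ^ k \<le> \<nu>.prob {x. B k < \<bar>x\<bar>}"
    using \<nu>.tail_lower[OF B ratio \<beta>1 \<beta>2 c C] by blast
  show ?thesis by (rule \<nu>.tail_window[OF B ratio \<beta>1 p C])
qed

section \<open>The bootstrap distribution under dominant clusters\<close>

abbreviation signs :: "nat \<Rightarrow> (nat \<Rightarrow> real) set" where
  "signs G \<equiv> PiE {..<G} (\<lambda>_. {-1, 1})"

lemma card_signs: "card (signs G) = 2 ^ G"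
  by (simp add: card_PiE numeral_2_eq_2)

lemma signs_cases:
  assumes "v \<in> signs G" "g < G"
  shows "v g = -1 \<or> v g = 1"
proof -
  have "v g \<in> {-1, 1}" by (rule PiE_mem[OF assms(1)]) (simp add: assms(2))
  then show ?thesis by blast
qed

lemma signs_mult_self:
  assumes "v \<in> signs G" "g < G"
  shows "v g * v g = 1"
  using signs_cases[OF assms] by (elim disjE) simp_all

text \<open>Reindexing along this involution shows that a sum odd in one coordinate vanishes, which
  plays the part of independence and symmetry of the weights.\<close>

lemma bij_betw_flip_sign:
  assumes "g < G"
  shows "bij_betw (\<lambda>v. v(g := - v g)) (signs G) (signs G)"
proof -
  have "v(g := - v g) \<in> signs G" if v: "v \<in> signs G" for v
  proof (rule PiE_I)
    fix h assume h: "h \<in> {..<G}"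
    show "(v(g := - v g)) h \<in> {-1, 1}"
    proof (cases "h = g")
      case True
      then show ?thesis using signs_cases[OF v assms] by (elim disjE) simp_all
    next
      case False
      then show ?thesis using PiE_mem[OF v h] by simp
    qed
  next
    fix h assume "h \<notin> {..<G}"
    then have "v h = undefined" "h \<noteq> g" using PiE_arb[OF v] assms by blast+
    then show "(v(g := - v g)) h = undefined" by simp
  qed
  then show ?thesis
    by (intro bij_betw_byWitness[where f' = "\<lambda>v. v(g := - v g)"]) (simp_all add: image_subset_iff)
qed

lemma sum_signs_coord:
  assumes "g < G"
  shows "(\<Sum>v\<in>signs G. v g) = 0"
  using sum.reindex_bij_betw[OF bij_betw_flip_sign[OF assms], of "\<lambda>v. v g"]
  by (simp add: sum_negf)

lemma sum_signs_mult:
  assumes "g < G" "h < G"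
  shows "(\<Sum>v\<in>signs G. v g * v h) = (if g = h then 2 ^ G else 0)"
proof (cases "g = h")
  case True
  have "(\<Sum>v\<in>signs G. v g * v h) = (\<Sum>v\<in>signs G. 1)"
    using True assms by (intro sum.cong refl) (simp add: signs_mult_self)
  then show ?thesis using True by (simp add: card_signs)
next
  case False
  then show ?thesis
    using sum.reindex_bij_betw[OF bij_betw_flip_sign[OF assms(1)], of "\<lambda>v. v g * v h"]
    by (simp add: sum_negf)
qed

text \<open>The coordinates are orthogonal under averaging, so the cross terms disappear. This is
  the variance needed for Chebyshev's inequality over the sign vectors.\<close>

lemma sum_signs_mult_selfuare:
  assumes "J \<subseteq> {..<G}"
  shows "(\<Sum>v\<in>signs G. (\<Sum>g\<in>J. v g * s g)\<^sup>2) = 2 ^ G * (\<Sum>g\<in>J. (s g)\<^sup>2)"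
proof -
  have fin: "finite J" using assms finite_subset by blast
  have "(\<Sum>v\<in>signs G. (\<Sum>g\<in>J. v g * s g)\<^sup>2)
      = (\<Sum>v\<in>signs G. \<Sum>g\<in>J. \<Sum>h\<in>J. (v g * v h) * (s g * s h))"
    unfolding power2_eq_square sum_product by (simp add: mult_ac)
  also have "\<dots> = (\<Sum>g\<in>J. \<Sum>v\<in>signs G. \<Sum>h\<in>J. (v g * v h) * (s g * s h))"
    by (rule sum.swap)
  also have "\<dots> = (\<Sum>g\<in>J. \<Sum>h\<in>J. \<Sum>v\<in>signs G. (v g * v h) * (s g * s h))"
    by (intro sum.cong refl sum.swap)
  also have "\<dots> = (\<Sum>g\<in>J. \<Sum>h\<in>J. (if g = h then 2 ^ G * (s g * s h) else 0))"
  proof (intro sum.cong refl)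
    fix g h assume "g \<in> J" "h \<in> J"
    then show "(\<Sum>v\<in>signs G. (v g * v h) * (s g * s h)) = (if g = h then 2 ^ G * (s g * s h) else 0)"
      using assms sum_signs_mult[of g G h] by (simp add: subset_iff flip: sum_distrib_right)
  qed
  also have "\<dots> = 2 ^ G * (\<Sum>g\<in>J. (s g)\<^sup>2)"
    using fin by (simp add: sum.delta' power2_eq_square sum_distrib_left)
  finally show ?thesis .
qed

text \<open>Squaring removes the signs of the residual sums, so \<open>v\<close> affects the
  denominator only through the bootstrap mean. Writing the denominator as a norm makes the triangle
  inequality available.\<close>

lemma clTstar_eq:
  assumes v: "v \<in> signs G" and s: "\<And>g. s g = (\<Sum>i<n g. y g i)"
  shows "clTstar G n y v = (\<Sum>g<G. v g * s g) /
     L2_set (\<lambda>g. s g - real (n g) * ((\<Sum>g<G. v g * s g) / (\<Sum>g<G. real (n g)))) {..<G}"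
proof -
  have "(v g * (\<Sum>i<n g. y g i - th))\<^sup>2 = (s g - real (n g) * th)\<^sup>2" if "g < G" for g th
  proof -
    have "(v g)\<^sup>2 = 1" using signs_mult_self[OF v that] by (simp add: power2_eq_square)
    then show ?thesis by (simp add: power_mult_distrib sum_subtractf s)
  qed
  then show ?thesis
    unfolding clTstar_def Let_def L2_set_def by (simp add: s)
qed

lemma clT_eq:
  assumes s: "\<And>g. s g = (\<Sum>i<n g. y g i)"
  shows "clT G n y = (\<Sum>g<G. s g) /
     L2_set (\<lambda>g. s g - real (n g) * ((\<Sum>g<G. s g) / (\<Sum>g<G. real (n g)))) {..<G}"
  unfolding clT_def Let_def L2_set_def by (simp add: sum_subtractf s)

text \<open>The residual cluster sums differ from the cluster sums by \<open>n g * th\<close>, which is negligible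
  as soon as no cluster holds a sizeable share of the sample.\<close>
lemma L2_set_residual:
  fixes s :: "nat \<Rightarrow> real"
  assumes n1: "\<And>g. g < G \<Longrightarrow> 1 \<le> n g" and n2: "\<And>g. g < G \<Longrightarrow> real (n g) \<le> \<delta>\<^sup>2 * real G"
    and "0 \<le> \<delta>"
  shows "\<bar>L2_set (\<lambda>g. s g - real (n g) * (x / (\<Sum>g<G. real (n g)))) {..<G} - L2_set s {..<G}\<bar>
           \<le> \<delta> * \<bar>x\<bar>"
proof (cases "G = 0")
  case True
  then show ?thesis using assms by (simp add: L2_set_def)
next
  case False
  let ?NN = "\<Sum>g<G. real (n g)" and ?th = "x / (\<Sum>g<G. real (n g))"
  have "real G = (\<Sum>g<G. 1)" by simp
  also have "\<dots> \<le> ?NN" using n1 by (intro sum_mono) force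
  finally have NN: "real G \<le> ?NN" .
  have pos: "0 < ?NN" using NN False by linarith
  \<comment> \<open>The sum of squares is at most the largest size times the total, and
    \<open>G\<close> is at most the total since every cluster is nonempty.\<close>
  have "(\<Sum>g<G. (real (n g))\<^sup>2) \<le> (\<Sum>g<G. (\<delta>\<^sup>2 * real G) * real (n g))"
    unfolding power2_eq_square using n2 by (intro sum_mono mult_right_mono) (auto simp: power2_eq_square)
  also have "\<dots> = \<delta>\<^sup>2 * (real G * ?NN)" by (simp add: sum_distrib_left mult_ac)
  also have "\<dots> \<le> \<delta>\<^sup>2 * (?NN * ?NN)"
    using NN pos by (intro mult_left_mono mult_right_mono) auto
  also have "\<dots> = (\<delta> * ?NN)\<^sup>2" by (simp add: power2_eq_square mult_ac)
  finally have n: "L2_set (\<lambda>g. real (n g)) {..<G} \<le> \<delta> * ?NN"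
    unfolding L2_set_def using pos assms by (simp add: real_le_lsqrt)
  have "L2_set (\<lambda>g. \<bar>?th\<bar> * real (n g)) {..<G} = \<bar>?th\<bar> * L2_set (\<lambda>g. real (n g)) {..<G}"
    by (rule L2_set_right_distrib[symmetric]) simp
  also have "\<dots> \<le> \<bar>?th\<bar> * (\<delta> * ?NN)" by (intro mult_left_mono n) auto
  also have "\<dots> = \<delta> * \<bar>x\<bar>" using pos by (simp add: abs_divide)
  finally have k: "L2_set (\<lambda>g. \<bar>?th\<bar> * real (n g)) {..<G} \<le> \<delta> * \<bar>x\<bar>" .
  \<comment> \<open>The scaling rule for \<open>L2_set\<close> wants a nonnegative factor; this form
    serves both \<open>?th\<close> and its negative.\<close>
  have e: "L2_set (\<lambda>g. c * real (n g)) {..<G} = L2_set (\<lambda>g. \<bar>?th\<bar> * real (n g)) {..<G}"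
    if c: "\<bar>c\<bar> = \<bar>?th\<bar>" for c
  proof -
    have "(c * real (n g))\<^sup>2 = (\<bar>?th\<bar> * real (n g))\<^sup>2" for g
      by (metis c power2_abs power_mult_distrib)
    then show ?thesis unfolding L2_set_def by simp
  qed
  have "L2_set s {..<G} = L2_set (\<lambda>g. (s g - real (n g) * ?th) + ?th * real (n g)) {..<G}"
    by (simp add: mult.commute)
  also have "\<dots> \<le> L2_set (\<lambda>g. s g - real (n g) * ?th) {..<G} + L2_set (\<lambda>g. ?th * real (n g)) {..<G}"
    by (rule L2_set_triangle_ineq)
  finally have 1: "L2_set s {..<G} \<le> L2_set (\<lambda>g. s g - real (n g) * ?th) {..<G} + \<delta> * \<bar>x\<bar>"
    using k e[of ?th] by linarith
  have "L2_set (\<lambda>g. s g - real (n g) * ?th) {..<G} = L2_set (\<lambda>g. s g + (- ?th) * real (n g)) {..<G}"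
    by (simp add: mult.commute)
  also have "\<dots> \<le> L2_set s {..<G} + L2_set (\<lambda>g. (- ?th) * real (n g)) {..<G}"
    by (rule L2_set_triangle_ineq)
  finally have 2: "L2_set (\<lambda>g. s g - real (n g) * ?th) {..<G} \<le> L2_set s {..<G} + \<delta> * \<bar>x\<bar>"
    using k e[of "- ?th"] by linarith
  show ?thesis using 1 2 by linarith
qed

text \<open>If the signed sum \<open>X'\<close> of the other clusters is at most
  \<open>\<rho> / 4 * a\<close> in absolute value, numerator and denominator are both
  \<open>\<bar>s g0\<bar>\<close> up to small relative errors, and the slack \<open>\<rho>\<close>
  absorbs them. By Chebyshev at most 1/16 of the sign vectors violate this.\<close>

lemma boot_cdf_one_dominant:
  fixes s :: "nat \<Rightarrow> real"
  assumes s: "\<And>g. s g = (\<Sum>i<n g. y g i)"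
    and n: "\<And>g. g < G \<Longrightarrow> 1 \<le> n g" "\<And>g. g < G \<Longrightarrow> real (n g) \<le> (\<rho> / 4)\<^sup>2 * real G"
    and \<rho>: "0 < \<rho>" "\<rho> \<le> 1 / 32"
    and g0: "g0 < G" "0 < a" "a < \<bar>s g0\<bar>"
    and rest: "(\<Sum>g\<in>{..<G} - {g0}. (s g)\<^sup>2) \<le> (\<rho> / 4)\<^sup>2 / 16 * a\<^sup>2"
  shows "15 / 16 \<le> boot_cdf G n y (1 + \<rho>)"
proof -
  define J where "J = {..<G} - {g0}"
  define X where "X = (\<lambda>v. \<Sum>g<G. v g * s g)"
  define X' where "X' = (\<lambda>v. \<Sum>g\<in>J. v g * s g)"
  \<comment> \<open>Chebyshev in pointwise form: the right side is at most 0 exactly when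
    \<open>X'\<close> reaches the tolerance in absolute value, and at most 1 otherwise.\<close>
  have "(if clTstar G n y v \<le> 1 + \<rho> then 1 else 0) \<ge> 1 - (X' v)\<^sup>2 / (\<rho> / 4 * a)\<^sup>2"
    if v: "v \<in> signs G" for v
  proof (cases "\<bar>X' v\<bar> \<le> \<rho> / 4 * a")
    case False
    then have "\<bar>\<rho> / 4 * a\<bar> \<le> \<bar>X' v\<bar>" using \<rho> g0 by (simp add: abs_mult)
    then have "(\<rho> / 4 * a)\<^sup>2 \<le> (X' v)\<^sup>2" by (simp only: abs_le_square_iff)
    then have "1 \<le> (X' v)\<^sup>2 / (\<rho> / 4 * a)\<^sup>2" using \<rho> g0 by simp
    then show ?thesis by (auto simp: algebra_simps)
  next
    case True
    let ?L = "L2_set (\<lambda>g. s g - real (n g) * (X v / (\<Sum>g<G. real (n g)))) {..<G}"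
    have X: "X v = v g0 * s g0 + X' v"
      unfolding X_def X'_def J_def using g0 by (subst sum.remove[of _ g0]) auto
    have "\<bar>v g0 * s g0\<bar> = \<bar>s g0\<bar>" using signs_cases[OF v g0(1)] by auto
    then have "\<bar>X v\<bar> \<le> \<bar>s g0\<bar> + \<rho> / 4 * a" using X True by linarith
    also have "\<dots> \<le> \<bar>s g0\<bar> + \<rho> / 4 * \<bar>s g0\<bar>" using g0 \<rho> by (intro add_left_mono mult_left_mono) auto
    finally have Xb: "\<bar>X v\<bar> \<le> (1 + \<rho> / 4) * \<bar>s g0\<bar>" by (simp add: algebra_simps)
    have "\<bar>s g0\<bar> \<le> L2_set s {..<G}"
      using member_le_L2_set[of "{..<G}" g0 "\<lambda>g. \<bar>s g\<bar>"] g0 by (simp add: L2_set_def)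
    moreover have "\<bar>?L - L2_set s {..<G}\<bar> \<le> \<rho> / 4 * \<bar>X v\<bar>"
      using n \<rho> by (intro L2_set_residual) auto
    ultimately have L: "\<bar>s g0\<bar> - \<rho> / 4 * ((1 + \<rho> / 4) * \<bar>s g0\<bar>) \<le> ?L"
      using mult_left_mono[OF Xb, of "\<rho> / 4"] \<rho> by linarith
    have p: "1 + \<rho> / 4 \<le> (1 + \<rho>) * (1 - \<rho> / 4 * (1 + \<rho> / 4))"
    proof -
      have "(1 + \<rho>) * (1 + \<rho> / 4) \<le> (1 + 1 / 32) * (1 + (1 / 32) / 4)"
        using \<rho> by (intro mult_mono) auto
      then have "\<rho> / 4 * ((1 + \<rho>) * (1 + \<rho> / 4)) \<le> \<rho> / 4 * 2"
        using \<rho> by (intro mult_left_mono) auto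
      moreover have "(1 + \<rho>) * (1 - \<rho> / 4 * (1 + \<rho> / 4)) = 1 + \<rho> - \<rho> / 4 * ((1 + \<rho>) * (1 + \<rho> / 4))"
        by (simp add: field_simps)
      ultimately show ?thesis using \<rho> by linarith
    qed
    have q: "0 < 1 - \<rho> / 4 * (1 + \<rho> / 4)"
    proof -
      have "\<rho> / 4 * (1 + \<rho> / 4) \<le> (1 / 32) / 4 * (1 + (1 / 32) / 4)"
        using \<rho> by (intro mult_mono) auto
      then show ?thesis by simp
    qed
    have "X v \<le> (1 + \<rho> / 4) * \<bar>s g0\<bar>" using Xb by linarith
    also have "\<dots> \<le> (1 + \<rho>) * (1 - \<rho> / 4 * (1 + \<rho> / 4)) * \<bar>s g0\<bar>"
      using p by (intro mult_right_mono) auto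
    also have "\<dots> \<le> (1 + \<rho>) * ?L"
      using mult_left_mono[OF L, of "1 + \<rho>"] \<rho> by (simp add: algebra_simps)
    finally have XL: "X v \<le> (1 + \<rho>) * ?L" .
    have "0 < \<bar>s g0\<bar> * (1 - \<rho> / 4 * (1 + \<rho> / 4))" using q g0 by (intro mult_pos_pos) auto
    then have "0 < ?L" using L by (simp add: algebra_simps)
    then have "clTstar G n y v \<le> 1 + \<rho>"
      unfolding clTstar_eq[OF v s] using XL by (simp add: X_def divide_le_eq)
    then show ?thesis by simp
  qed
  then have "(\<Sum>v\<in>signs G. 1 - (X' v)\<^sup>2 / (\<rho> / 4 * a)\<^sup>2) / 2 ^ G \<le> boot_cdf G n y (1 + \<rho>)"
    unfolding boot_cdf_def by (intro divide_right_mono sum_mono) auto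
  moreover have "(\<Sum>v\<in>signs G. 1 - (X' v)\<^sup>2 / (\<rho> / 4 * a)\<^sup>2) / 2 ^ G
      = 1 - (\<Sum>g\<in>J. (s g)\<^sup>2) / (\<rho> / 4 * a)\<^sup>2"
    using sum_signs_mult_selfuare[of J G s]
    by (simp add: sum_subtractf card_signs X'_def J_def diff_divide_distrib flip: sum_divide_distrib)
  moreover have "(\<Sum>g\<in>J. (s g)\<^sup>2) / (\<rho> / 4 * a)\<^sup>2 \<le> 1 / 16"
    using rest \<rho> g0 by (simp add: J_def power_mult_distrib power_divide field_simps)
  ultimately show ?thesis by linarith
qed

text \<open>For \<open>x\<close> and \<open>y\<close> within a factor \<open>R\<close>, the cross
  term \<open>2 * (x * y)\<close> is at least the share \<open>1 / (2 * R)\<close> of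
  \<open>(x + y)\<^sup>2\<close>. The remainder \<open>w\<close> consumes at most half of it, and
  the other half separates the l2 norm from the l1 norm.\<close>

lemma two_dominant_le:
  fixes x y a R :: real
  assumes "0 < a" "a < x" "x \<le> R * a" "a < y" "y \<le> R * a" "1 \<le> R" "w \<le> a\<^sup>2 / (4 * R)"
  shows "sqrt (x\<^sup>2 + y\<^sup>2 + w) \<le> (x + y) * (1 - 1 / (8 * R))"
proof (rule real_le_lsqrt)
  show "0 \<le> (x + y) * (1 - 1 / (8 * R))" using assms by (intro mult_nonneg_nonneg) (auto simp: field_simps)
  have xy: "x \<le> R * y" "y \<le> R * x"
    using assms by (meson mult_left_mono order.trans less_imp_le zero_le_one)+
  have "(x + y)\<^sup>2 \<le> 4 * R * (x * y)"
  proof -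
    have "x * x \<le> x * (R * y)" "y * y \<le> y * (R * x)" "1 * (x * y) \<le> R * (x * y)"
      using assms xy by (intro mult_left_mono mult_right_mono; simp)+
    then show ?thesis by (simp add: power2_eq_square algebra_simps)
  qed
  then have 1: "(x + y)\<^sup>2 / (2 * R) \<le> 2 * (x * y)" using assms by (simp add: field_simps)
  have "a * a \<le> (x + y) * (x + y)" using assms by (intro mult_mono) auto
  then have "a\<^sup>2 / (4 * R) \<le> (x + y)\<^sup>2 / (4 * R)"
    using assms by (intro divide_right_mono) (auto simp: power2_eq_square)
  then have 2: "w \<le> (x + y)\<^sup>2 / (4 * R)" using assms by linarith
  have "x\<^sup>2 + y\<^sup>2 + w = (x + y)\<^sup>2 - 2 * (x * y) + w" by (simp add: power2_eq_square algebra_simps)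
  also have "\<dots> \<le> (x + y)\<^sup>2 - (x + y)\<^sup>2 / (4 * R)" using 1 2 by (simp add: field_simps)
  also have "\<dots> = (x + y)\<^sup>2 * (1 - 2 * (1 / (8 * R)))" by (simp add: field_simps)
  also have "\<dots> \<le> (x + y)\<^sup>2 * (1 - 1 / (8 * R))\<^sup>2"
    by (intro mult_left_mono zero_le_power2) (simp add: power2_eq_square algebra_simps)
  finally show "x\<^sup>2 + y\<^sup>2 + w \<le> ((x + y) * (1 - 1 / (8 * R)))\<^sup>2" by (simp add: power_mult_distrib)
qed

text \<open>A quarter of the sign vectors agree with the signs of both dominant sums. For these,
  unless \<open>X'\<close> is large, the numerator is nearly \<open>\<sigma>\<close> while the
  denominator is smaller by a fixed factor. Chebyshev discards at most 1/16, and 1 - 1/4 + 1/16 =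
  13/16.\<close>

lemma boot_cdf_two_dominant:
  fixes s :: "nat \<Rightarrow> real"
  assumes s: "\<And>g. s g = (\<Sum>i<n g. y g i)"
    and n: "\<And>g. g < G \<Longrightarrow> 1 \<le> n g" "\<And>g. g < G \<Longrightarrow> real (n g) \<le> (\<rho> / 4)\<^sup>2 * real G"
    and R: "1 \<le> R" and \<rho>: "\<rho> = 1 / (32 * R)"
    and g: "g1 < G" "g2 < G" "g1 \<noteq> g2" and a: "0 < a"
    and s1: "a < \<bar>s g1\<bar>" "\<bar>s g1\<bar> \<le> R * a" and s2: "a < \<bar>s g2\<bar>" "\<bar>s g2\<bar> \<le> R * a"
    and rest: "(\<Sum>g\<in>{..<G} - {g1, g2}. (s g)\<^sup>2) \<le> (\<rho> / 4)\<^sup>2 / 16 * a\<^sup>2"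
  shows "boot_cdf G n y (1 + \<rho>) \<le> 13 / 16"
proof -
  define J where "J = {..<G} - {g1, g2}"
  define X where "X = (\<lambda>v. \<Sum>g<G. v g * s g)"
  define X' where "X' = (\<lambda>v. \<Sum>g\<in>J. v g * s g)"
  define \<sigma> where "\<sigma> = \<bar>s g1\<bar> + \<bar>s g2\<bar>"
  \<comment> \<open>On sign vectors this is the indicator that both signs match. As a polynomial in
    \<open>v g1\<close> and \<open>v g2\<close> it can be averaged by orthogonality.\<close>
  define Q where "Q = (\<lambda>v. (1 + sgn (s g1) * v g1) * (1 + sgn (s g2) * v g2) / (4::real))"
  have \<rho>0: "0 < \<rho>" "\<rho> \<le> 1 / 32" using R by (auto simp: \<rho> field_simps)
  have split: "(\<Sum>g<G. f g) = f g1 + f g2 + (\<Sum>g\<in>J. f g)" for f :: "nat \<Rightarrow> real"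
  proof -
    have e: "{..<G} - {g1} - {g2} = J" by (auto simp: J_def)
    have "(\<Sum>g<G. f g) = f g1 + (\<Sum>g\<in>{..<G} - {g1}. f g)"
      using g by (intro sum.remove) auto
    also have "(\<Sum>g\<in>{..<G} - {g1}. f g) = f g2 + (\<Sum>g\<in>J. f g)"
      using g by (subst sum.remove[of _ g2]) (auto simp: e)
    finally show ?thesis by simp
  qed
  have "(\<Sum>g\<in>J. (s g)\<^sup>2) \<le> (\<rho> / 4)\<^sup>2 / 16 * a\<^sup>2" using rest by (simp add: J_def)
  also have "\<dots> \<le> 1 / (4 * R) * a\<^sup>2"
  proof (rule mult_right_mono)
    have "\<rho> * \<rho> \<le> \<rho> * 1" using \<rho>0 by (intro mult_left_mono) auto
    then have "(\<rho> / 4)\<^sup>2 / 16 \<le> \<rho>" using \<rho>0 by (simp add: power2_eq_square)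
    also have "\<dots> \<le> 1 / (4 * R)" using R by (simp add: \<rho> field_simps)
    finally show "(\<rho> / 4)\<^sup>2 / 16 \<le> 1 / (4 * R)" .
  qed simp
  finally have w: "(\<Sum>g\<in>J. (s g)\<^sup>2) \<le> a\<^sup>2 / (4 * R)" by simp
  have "L2_set s {..<G} = sqrt (\<bar>s g1\<bar>\<^sup>2 + \<bar>s g2\<bar>\<^sup>2 + (\<Sum>g\<in>J. (s g)\<^sup>2))"
    unfolding L2_set_def split by simp
  also have "\<dots> \<le> \<sigma> * (1 - 1 / (8 * R))"
    unfolding \<sigma>_def using s1 s2 a R w by (intro two_dominant_le) auto
  \<comment> \<open>The choice of \<open>\<rho>\<close> makes the gap \<open>4 * \<rho>\<close>,
    enough for the residual correction \<open>\<rho> / 2\<close>, the other clusters'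
    \<open>\<rho> / 8\<close> and the factor \<open>1 + \<rho>\<close>.\<close>
  also have "\<dots> = \<sigma> * (1 - 4 * \<rho>)" using R by (simp add: \<rho> field_simps)
  finally have LV: "L2_set s {..<G} \<le> \<sigma> * (1 - 4 * \<rho>)" .
  have \<sigma>a: "2 * a \<le> \<sigma>" using s1 s2 by (simp add: \<sigma>_def)
  have "(if clTstar G n y v \<le> 1 + \<rho> then 1 else 0) \<le> 1 - Q v + (X' v)\<^sup>2 / (\<rho> / 4 * a)\<^sup>2"
    if v: "v \<in> signs G" for v
  proof -
    have vs: "v g1 = -1 \<or> v g1 = 1" "v g2 = -1 \<or> v g2 = 1" using signs_cases[OF v] g by blast+
    have sg: "sgn (s g1) = 1 \<or> sgn (s g1) = -1" "sgn (s g2) = 1 \<or> sgn (s g2) = -1"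
      using s1 s2 a by (auto simp: sgn_if)
    have Q1: "Q v \<le> 1" unfolding Q_def using vs sg by auto
    show ?thesis
    proof (cases "\<bar>X' v\<bar> \<le> \<rho> / 4 * a")
      case False
      then have "\<bar>\<rho> / 4 * a\<bar> \<le> \<bar>X' v\<bar>" using \<rho>0 a by (simp add: abs_mult)
      then have "(\<rho> / 4 * a)\<^sup>2 \<le> (X' v)\<^sup>2" by (simp only: abs_le_square_iff)
      then have "1 \<le> (X' v)\<^sup>2 / (\<rho> / 4 * a)\<^sup>2" using \<rho>0 a by simp
      then show ?thesis using Q1 by auto
    next
      case True
      show ?thesis
      proof (cases "v g1 = sgn (s g1) \<and> v g2 = sgn (s g2)")
        case False
        then have "Q v = 0" unfolding Q_def using vs sg by auto
        then show ?thesis by auto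
      next
        case eq: True
        let ?L = "L2_set (\<lambda>g. s g - real (n g) * (X v / (\<Sum>g<G. real (n g)))) {..<G}"
        have X: "X v = \<sigma> + X' v"
        proof -
          have "v g1 * s g1 = \<bar>s g1\<bar>" "v g2 * s g2 = \<bar>s g2\<bar>"
            using eq by (metis abs_sgn mult.commute)+
          then show ?thesis unfolding X_def X'_def split \<sigma>_def by simp
        qed
        have "\<rho> / 4 * a \<le> \<rho> / 8 * \<sigma>" using \<sigma>a \<rho>0 mult_left_mono[of "2 * a" \<sigma> "\<rho> / 8"] by simp
        then have Xb: "\<sigma> * (1 - \<rho> / 8) \<le> X v" "X v \<le> \<sigma> * (1 + \<rho> / 8)"
          using X True by (auto simp: algebra_simps)
        have \<sigma>0: "0 < \<sigma>" using \<sigma>a a by linarith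
        then have "0 < \<sigma> * (1 - \<rho> / 8)" using \<rho>0 by (intro mult_pos_pos) auto
        then have X0: "0 < X v" using Xb(1) by linarith
        have "\<bar>?L - L2_set s {..<G}\<bar> \<le> \<rho> / 4 * \<bar>X v\<bar>"
          using n \<rho>0 by (intro L2_set_residual) auto
        then have res: "\<bar>?L - L2_set s {..<G}\<bar> \<le> \<rho> / 4 * X v" using X0 by simp
        have \<rho>X: "\<rho> / 4 * X v \<le> \<rho> / 4 * (\<sigma> * (1 + \<rho> / 8))" using Xb \<rho>0 by (intro mult_left_mono) auto
        also have "\<dots> \<le> \<rho> / 4 * (\<sigma> * 2)" using \<rho>0 \<sigma>0 by (intro mult_left_mono) auto
        finally have \<rho>X: "\<rho> / 4 * X v \<le> \<sigma> * (\<rho> / 2)" by (simp add: mult_ac)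
        have "?L \<le> \<sigma> * (1 - 4 * \<rho>) + \<sigma> * (\<rho> / 2)" using LV res \<rho>X by linarith
        also have "\<dots> = \<sigma> * (1 - 7 / 2 * \<rho>)" by (simp add: algebra_simps)
        also have "\<dots> \<le> \<sigma> * (1 - 3 * \<rho>)" using \<sigma>0 \<rho>0 by (intro mult_left_mono) auto
        finally have "(1 + \<rho>) * ?L \<le> (1 + \<rho>) * (\<sigma> * (1 - 3 * \<rho>))"
          using \<rho>0 by (intro mult_left_mono) auto
        also have "\<dots> = \<sigma> * ((1 + \<rho>) * (1 - 3 * \<rho>))" by simp
        also have "\<dots> < \<sigma> * (1 - \<rho> / 8)"
        proof (rule mult_strict_left_mono[OF _ \<sigma>0])
          have "(1 + \<rho>) * (1 - 3 * \<rho>) = 1 - 2 * \<rho> - 3 * \<rho>\<^sup>2"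
            by (simp add: power2_eq_square algebra_simps)
          moreover have "0 \<le> \<rho>\<^sup>2" by simp
          ultimately show "(1 + \<rho>) * (1 - 3 * \<rho>) < 1 - \<rho> / 8" using \<rho>0 by linarith
        qed
        finally have less: "(1 + \<rho>) * ?L < X v" using Xb by linarith
        \<comment> \<open>Positivity of the denominator matters: division by 0 would make the
          statistic 0, which is below \<open>1 + \<rho>\<close>.\<close>
        have "\<bar>s g1\<bar> \<le> L2_set s {..<G}" "\<bar>s g2\<bar> \<le> L2_set s {..<G}"
          using member_le_L2_set[of "{..<G}" _ "\<lambda>g. \<bar>s g\<bar>"] g by (simp_all add: L2_set_def)
        then have "\<sigma> / 2 \<le> L2_set s {..<G}" by (simp add: \<sigma>_def)
        moreover have "\<sigma> * (\<rho> / 2) \<le> \<sigma> * (1 / 4)" using \<sigma>0 \<rho>0 by (intro mult_left_mono) auto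
        ultimately have "0 < ?L" using res \<rho>X \<sigma>0 by linarith
        then have "\<not> clTstar G n y v \<le> 1 + \<rho>"
          unfolding clTstar_eq[OF v s] using less by (simp add: X_def divide_le_eq)
        then show ?thesis using Q1 by simp
      qed
    qed
  qed
  then have "boot_cdf G n y (1 + \<rho>) \<le> (\<Sum>v\<in>signs G. 1 - Q v + (X' v)\<^sup>2 / (\<rho> / 4 * a)\<^sup>2) / 2 ^ G"
    unfolding boot_cdf_def by (intro divide_right_mono sum_mono) auto
  also have "\<dots> = 1 - (\<Sum>v\<in>signs G. Q v) / 2 ^ G + (\<Sum>g\<in>J. (s g)\<^sup>2) / (\<rho> / 4 * a)\<^sup>2"
  proof -
    have "(\<Sum>v\<in>signs G. (X' v)\<^sup>2) = 2 ^ G * (\<Sum>g\<in>J. (s g)\<^sup>2)"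
      unfolding X'_def by (rule sum_signs_mult_selfuare) (auto simp: J_def)
    moreover have "(\<Sum>v\<in>signs G. 1 - Q v + (X' v)\<^sup>2 / (\<rho> / 4 * a)\<^sup>2)
        = 2 ^ G - (\<Sum>v\<in>signs G. Q v) + (\<Sum>v\<in>signs G. (X' v)\<^sup>2) / (\<rho> / 4 * a)\<^sup>2"
      by (simp only: sum.distrib sum_subtractf sum_divide_distrib) (simp add: card_signs)
    ultimately show ?thesis by (simp add: diff_divide_distrib add_divide_distrib)
  qed
  also have "(\<Sum>v\<in>signs G. Q v) = 2 ^ G / 4"
  proof -
    have "(\<Sum>v\<in>signs G. Q v) = (\<Sum>v\<in>signs G. (1 + sgn (s g1) * v g1 + sgn (s g2) * v g2
        + (sgn (s g1) * sgn (s g2)) * (v g1 * v g2)) / 4)"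
      unfolding Q_def by (intro sum.cong refl) (simp add: algebra_simps)
    also have "\<dots> = ((\<Sum>v\<in>signs G. 1) + sgn (s g1) * (\<Sum>v\<in>signs G. v g1) + sgn (s g2) * (\<Sum>v\<in>signs G. v g2)
        + (sgn (s g1) * sgn (s g2)) * (\<Sum>v\<in>signs G. v g1 * v g2)) / 4"
      by (simp only: sum.distrib sum_distrib_left flip: sum_divide_distrib)
    also have "\<dots> = 2 ^ G / 4"
      using g by (simp add: sum_signs_coord sum_signs_mult card_signs)
    finally show ?thesis .
  qed
  also have "(\<Sum>g\<in>J. (s g)\<^sup>2) / (\<rho> / 4 * a)\<^sup>2 \<le> 1 / 16"
  proof -
    have "0 < (\<rho> / 4 * a)\<^sup>2" using \<rho>0 a by simp
    moreover have "(\<Sum>g\<in>J. (s g)\<^sup>2) \<le> 1 / 16 * (\<rho> / 4 * a)\<^sup>2"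
      using rest unfolding J_def power_mult_distrib by simp
    ultimately show ?thesis by (simp only: pos_divide_le_eq)
  qed
  finally show ?thesis by simp
qed

section \<open>Probability of dominant clusters\<close>

context prob_space
begin

text \<open>Markov's inequality after truncation at 1, which is subadditive; second moments of the
  summands need not be finite.\<close>

lemma prob_sum_squares_gt:
  assumes [measurable]: "\<And>g. X g \<in> borel_measurable M" and ident: "\<And>g. distr M borel (X g) = \<nu>"
    and "finite I" "0 < b"
  shows "prob {\<omega> \<in> space M. b < (\<Sum>g\<in>I. (X g \<omega>)\<^sup>2)} \<le> real (card I) * (\<integral>x. min 1 (x\<^sup>2 / b) \<partial>\<nu>)"
proof -
  have sub: "min 1 (sum f I) \<le> (\<Sum>g\<in>I. min 1 (f g))" if "\<And>g. 0 \<le> f g" for f :: "_ \<Rightarrow> real"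
    using \<open>finite I\<close>
  proof (induction I)
    case (insert g I)
    have "0 \<le> f g" "0 \<le> sum f I" by (auto intro: sum_nonneg that)
    then show ?case using insert by (auto simp: min_def split: if_splits)
  qed simp
  have int: "integrable M (\<lambda>\<omega>. min 1 ((X g \<omega>)\<^sup>2 / b))" for g
    using \<open>0 < b\<close> by (intro integrable_const_bound[of _ 1]) auto
  have "prob {\<omega> \<in> space M. b < (\<Sum>g\<in>I. (X g \<omega>)\<^sup>2)}
      = expectation (indicator {\<omega> \<in> space M. b < (\<Sum>g\<in>I. (X g \<omega>)\<^sup>2)})" by simp
  also have "\<dots> \<le> expectation (\<lambda>\<omega>. \<Sum>g\<in>I. min 1 ((X g \<omega>)\<^sup>2 / b))"
  proof (rule integral_mono)
    show "integrable M (indicat_real {\<omega> \<in> space M. b < (\<Sum>g\<in>I. (X g \<omega>)\<^sup>2)})"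
      by (intro integrable_real_indicator) (auto simp: emeasure_eq_measure)
    show "integrable M (\<lambda>\<omega>. \<Sum>g\<in>I. min 1 ((X g \<omega>)\<^sup>2 / b))" using int by (intro Bochner_Integration.integrable_sum)
    fix \<omega> assume "\<omega> \<in> space M"
    have "indicat_real {\<omega> \<in> space M. b < (\<Sum>g\<in>I. (X g \<omega>)\<^sup>2)} \<omega> \<le> min 1 (\<Sum>g\<in>I. (X g \<omega>)\<^sup>2 / b)"
      using \<open>0 < b\<close> by (auto simp: indicator_def le_divide_eq sum_nonneg simp flip: sum_divide_distrib)
    also have "\<dots> \<le> (\<Sum>g\<in>I. min 1 ((X g \<omega>)\<^sup>2 / b))" using \<open>0 < b\<close> by (intro sub) simp
    finally show "indicat_real {\<omega> \<in> space M. b < (\<Sum>g\<in>I. (X g \<omega>)\<^sup>2)} \<omega> \<le> (\<Sum>g\<in>I. min 1 ((X g \<omega>)\<^sup>2 / b))" .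
  qed
  also have "\<dots> = (\<Sum>g\<in>I. expectation (\<lambda>\<omega>. min 1 ((X g \<omega>)\<^sup>2 / b)))"
    using int by (intro Bochner_Integration.integral_sum)
  also have "\<dots> = (\<Sum>g\<in>I. \<integral>x. min 1 (x\<^sup>2 / b) \<partial>\<nu>)"
    by (intro sum.cong refl) (subst ident[symmetric], subst integral_distr, auto)
  finally show ?thesis by simp
qed

lemma prob_sum_squares_le_half:
  assumes X[measurable]: "\<And>g. X g \<in> borel_measurable M" and ident: "\<And>g. distr M borel (X g) = \<nu>"
    and I: "finite I" and b: "0 < b" and small: "real (card I) * (\<integral>x. min 1 (x\<^sup>2 / b) \<partial>\<nu>) \<le> 1 / 2"
  shows "1 / 2 \<le> prob {\<omega> \<in> space M. (\<Sum>h\<in>I. (X h \<omega>)\<^sup>2) \<le> b}"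
proof -
  have "prob {\<omega> \<in> space M. (\<Sum>h\<in>I. (X h \<omega>)\<^sup>2) \<le> b} = 1 - prob {\<omega> \<in> space M. b < (\<Sum>h\<in>I. (X h \<omega>)\<^sup>2)}"
    by (subst prob_compl[symmetric]) (auto intro!: arg_cong[where f = prob])
  then show ?thesis using prob_sum_squares_gt[where X = X, OF X ident I b] small by linarith
qed

lemma prob_disjoint_blocks:
  assumes indep: "indep_vars (\<lambda>_. borel) X UNIV" and AB: "A \<inter> B = {}"
    and P[measurable]: "Measurable.pred (PiM A (\<lambda>_. borel)) P"
    and Q[measurable]: "Measurable.pred (PiM B (\<lambda>_. borel)) Q"
  shows "prob {\<omega> \<in> space M. P (restrict (\<lambda>i. X i \<omega>) A) \<and> Q (restrict (\<lambda>i. X i \<omega>) B)}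
    = prob {\<omega> \<in> space M. P (restrict (\<lambda>i. X i \<omega>) A)} * prob {\<omega> \<in> space M. Q (restrict (\<lambda>i. X i \<omega>) B)}"
proof -
  let ?A = "\<lambda>\<omega>. restrict (\<lambda>i. X i \<omega>) A" and ?B = "\<lambda>\<omega>. restrict (\<lambda>i. X i \<omega>) B"
  let ?SA = "{x \<in> space (PiM A (\<lambda>_. borel)). P x}" and ?SB = "{x \<in> space (PiM B (\<lambda>_. borel)). Q x}"
  have "indep_var (PiM A (\<lambda>_. borel)) ?A (PiM B (\<lambda>_. borel)) ?B"
    by (rule indep_var_restrict[OF indep AB]) auto
  then have "prob ((\<lambda>\<omega>. (?A \<omega>, ?B \<omega>)) -` (?SA \<times> ?SB) \<inter> space M)
     = prob (?A -` ?SA \<inter> space M) * prob (?B -` ?SB \<inter> space M)"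
    by (rule indep_varD) auto
  moreover have "(\<lambda>\<omega>. (?A \<omega>, ?B \<omega>)) -` (?SA \<times> ?SB) \<inter> space M = {\<omega> \<in> space M. P (?A \<omega>) \<and> Q (?B \<omega>)}"
    by (auto simp: space_PiM)
  moreover have "?A -` ?SA \<inter> space M = {\<omega> \<in> space M. P (?A \<omega>)}" "?B -` ?SB \<inter> space M = {\<omega> \<in> space M. Q (?B \<omega>)}"
    by (auto simp: space_PiM)
  ultimately show ?thesis by simp
qed

text \<open>The events for different \<open>g\<close> are disjoint: a second sum above
  \<open>a\<close> would contribute more than \<open>a\<^sup>2 \<ge> b\<close> to the remaining
  squares. Their probabilities therefore add up, and independence bounds each from below by half the
  window probability.\<close>

lemma prob_one_dominant:
  assumes indep: "indep_vars (\<lambda>_. borel) X UNIV" and ident: "\<And>g. distr M borel (X g) = \<nu>"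
    and I: "finite I" and a: "0 < a" and b: "0 < b" "b \<le> a\<^sup>2"
    and p: "p \<le> real (card I) * measure \<nu> {x. a < \<bar>x\<bar> \<and> \<bar>x\<bar> \<le> R * a}"
    and small: "real (card I) * (\<integral>x. min 1 (x\<^sup>2 / b) \<partial>\<nu>) \<le> 1 / 2"
  shows "p / 2 \<le> prob {\<omega> \<in> space M. \<exists>g\<in>I. a < \<bar>X g \<omega>\<bar> \<and> \<bar>X g \<omega>\<bar> \<le> R * a \<and> (\<Sum>h\<in>I - {g}. (X h \<omega>)\<^sup>2) \<le> b}"
proof -
  have X[measurable]: "X g \<in> borel_measurable M" for g using indep by (simp add: indep_vars_def)
  define q where "q = measure \<nu> {x. a < \<bar>x\<bar> \<and> \<bar>x\<bar> \<le> R * a}"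
  define E where "E = (\<lambda>g. {\<omega> \<in> space M. (a < \<bar>X g \<omega>\<bar> \<and> \<bar>X g \<omega>\<bar> \<le> R * a) \<and> (\<Sum>h\<in>I - {g}. (X h \<omega>)\<^sup>2) \<le> b})"
  have E[measurable]: "E g \<in> events" for g unfolding E_def by measurable
  have "disjoint_family_on E I"
    unfolding disjoint_family_on_def
  proof (intro ballI impI, rule ccontr)
    fix g h assume gh: "g \<in> I" "h \<in> I" "g \<noteq> h" and "E g \<inter> E h \<noteq> {}"
    then obtain \<omega> where \<omega>: "\<omega> \<in> E g" "\<omega> \<in> E h" by blast
    have "\<bar>a\<bar> < \<bar>X h \<omega>\<bar>" using \<omega> a by (simp add: E_def)
    then have "a\<^sup>2 < (X h \<omega>)\<^sup>2" by (metis abs_square_less_1 abs_le_square_iff linorder_not_le)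
    also have "\<dots> \<le> (\<Sum>h\<in>I - {g}. (X h \<omega>)\<^sup>2)" using gh I by (intro member_le_sum) auto
    also have "\<dots> \<le> b" using \<omega> by (simp add: E_def)
    finally show False using b by simp
  qed
  then have "prob (\<Union>g\<in>I. E g) = (\<Sum>g\<in>I. prob (E g))" using I by (intro finite_measure_finite_Union) auto
  moreover have "q * (1 / 2) \<le> prob (E g)" if "g \<in> I" for g
  proof -
    let ?P = "\<lambda>x. a < \<bar>x g\<bar> \<and> \<bar>x g\<bar> \<le> R * a" and ?Q = "\<lambda>x. (\<Sum>h\<in>I - {g}. (x h)\<^sup>2) \<le> b"
    have "prob {\<omega> \<in> space M. ?P (restrict (\<lambda>i. X i \<omega>) {g}) \<and> ?Q (restrict (\<lambda>i. X i \<omega>) (I - {g}))}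
        = prob {\<omega> \<in> space M. ?P (restrict (\<lambda>i. X i \<omega>) {g})} * prob {\<omega> \<in> space M. ?Q (restrict (\<lambda>i. X i \<omega>) (I - {g}))}"
    proof (rule prob_disjoint_blocks[OF indep])
      show "Measurable.pred (PiM {g} (\<lambda>_. borel)) ?P" by measurable
      show "Measurable.pred (PiM (I - {g}) (\<lambda>_. borel)) ?Q" by measurable
    qed auto
    then have "prob (E g) = prob {\<omega> \<in> space M. a < \<bar>X g \<omega>\<bar> \<and> \<bar>X g \<omega>\<bar> \<le> R * a}
        * prob {\<omega> \<in> space M. (\<Sum>h\<in>I - {g}. (X h \<omega>)\<^sup>2) \<le> b}"
      by (simp add: E_def cong: sum.cong_simp)
    moreover have "prob {\<omega> \<in> space M. a < \<bar>X g \<omega>\<bar> \<and> \<bar>X g \<omega>\<bar> \<le> R * a} = q"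
      unfolding q_def ident[of g, symmetric]
      by (subst measure_distr) (auto intro!: arg_cong[where f = prob])
    moreover have "1 / 2 \<le> prob {\<omega> \<in> space M. (\<Sum>h\<in>I - {g}. (X h \<omega>)\<^sup>2) \<le> b}"
    proof -
      have "real (card (I - {g})) * (\<integral>x. min 1 (x\<^sup>2 / b) \<partial>\<nu>) \<le> real (card I) * (\<integral>x. min 1 (x\<^sup>2 / b) \<partial>\<nu>)"
        using I b by (intro mult_right_mono Bochner_Integration.integral_nonneg) (auto intro: card_mono)
      then show ?thesis using I b small by (intro prob_sum_squares_le_half[OF X ident]) auto
    qed
    moreover have "0 \<le> q" by (simp add: q_def)
    ultimately show ?thesis by (simp only: mult_left_mono)
  qed
  ultimately have "(\<Sum>g\<in>I. q * (1 / 2)) \<le> prob (\<Union>g\<in>I. E g)" by (simp only: sum_mono)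
  moreover have "(\<Union>g\<in>I. E g) = {\<omega> \<in> space M. \<exists>g\<in>I. a < \<bar>X g \<omega>\<bar> \<and> \<bar>X g \<omega>\<bar> \<le> R * a \<and> (\<Sum>h\<in>I - {g}. (X h \<omega>)\<^sup>2) \<le> b}"
    by (auto simp: E_def)
  ultimately show ?thesis using p by (simp add: q_def)
qed

text \<open>The truncated mean of \<open>\<bar>Z\<bar>\<close> over \<open>Z > d * n\<close> tends
  to 0 and dominates \<open>d * n\<close> times the probability. With a union bound this rules out a
  cluster holding a fixed share of the sample.\<close>

lemma integrable_tail_prob:
  fixes Z :: "'a \<Rightarrow> real"
  assumes int: "integrable M Z" and d: "0 < d"
  shows "(\<lambda>n. real n * prob {\<omega> \<in> space M. d * real n < Z \<omega>}) \<longlonglongrightarrow> 0"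
proof -
  have [measurable]: "Z \<in> borel_measurable M" using int by simp
  define f where "f = (\<lambda>n \<omega>. \<bar>Z \<omega>\<bar> * indicator {\<omega> \<in> space M. d * real n < Z \<omega>} \<omega>)"
  have "(\<lambda>n. expectation (f n)) \<longlonglongrightarrow> expectation (\<lambda>_. 0)"
  proof (rule integral_dominated_convergence[where w = "\<lambda>\<omega>. \<bar>Z \<omega>\<bar>"])
    show "AE \<omega> in M. (\<lambda>n. f n \<omega>) \<longlonglongrightarrow> 0"
    proof (rule AE_I2, rule tendsto_eventually)
      fix \<omega> assume "\<omega> \<in> space M"
      obtain n0 where n0: "Z \<omega> / d < real n0" using reals_Archimedean2 by blast
      have "f n \<omega> = 0" if "n0 \<le> n" for n
      proof -
        have "Z \<omega> / d < real n" using n0 that by linarith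
        then have "Z \<omega> < d * real n" using d by (simp add: field_simps)
        then show ?thesis by (simp add: f_def)
      qed
      then show "\<forall>\<^sub>F n in sequentially. f n \<omega> = 0" by (auto simp: eventually_sequentially)
    qed
    show "integrable M (\<lambda>\<omega>. \<bar>Z \<omega>\<bar>)" using int by simp
    show "AE \<omega> in M. norm (f n \<omega>) \<le> \<bar>Z \<omega>\<bar>" for n by (auto simp: f_def indicator_def)
  qed (auto simp: f_def)
  then have lim: "(\<lambda>n. expectation (f n) / d) \<longlonglongrightarrow> 0" using tendsto_divide[OF _ tendsto_const, of _ 0 _ d] d by simp
  have "real n * prob {\<omega> \<in> space M. d * real n < Z \<omega>} \<le> expectation (f n) / d" for n
  proof -
    have "d * (real n * prob {\<omega> \<in> space M. d * real n < Z \<omega>})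
        = expectation (\<lambda>\<omega>. (d * real n) * indicator {\<omega> \<in> space M. d * real n < Z \<omega>} \<omega>)" by simp
    also have "\<dots> \<le> expectation (f n)"
    proof (rule integral_mono)
      show "integrable M (\<lambda>\<omega>. (d * real n) * indicat_real {\<omega> \<in> space M. d * real n < Z \<omega>} \<omega>)"
        by (intro integrable_mult_right integrable_real_indicator) (auto simp: emeasure_eq_measure)
      show "integrable M (f n)"
        unfolding f_def using int by (intro integrable_real_mult_indicator) auto
      show "(d * real n) * indicat_real {\<omega> \<in> space M. d * real n < Z \<omega>} \<omega> \<le> f n \<omega>" for \<omega>
        by (auto simp: f_def indicator_def)
    qed
    finally show ?thesis using d by (simp add: field_simps)
  qed
  then show ?thesis by (intro tendsto_sandwich[OF _ _ tendsto_const lim]) auto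
qed

end

section \<open>Range and one-sided continuity of the distribution functions\<close>

text \<open>Reduces the supremum over all real thresholds to countably many, as measurability
  requires.\<close>

lemma right_continuous_rational_witness:
  fixes f :: "real \<Rightarrow> real"
  assumes f: "(f \<longlongrightarrow> f t) (at_right t)" and "\<epsilon> < f t"
  shows "\<exists>q\<in>\<rat>. \<epsilon> < f q"
proof -
  have "\<forall>\<^sub>F s in at_right t. \<epsilon> < f s" using assms by (rule order_tendstoD(1))
  then obtain b where b: "t < b" "\<And>s. t < s \<Longrightarrow> s < b \<Longrightarrow> \<epsilon> < f s"
    by (auto simp: eventually_at_right_field)
  obtain q where "q \<in> \<rat>" "t < q" "q < b" using Rats_dense_in_real[OF b(1)] by blast
  then show ?thesis using b by blast
qed

lemma boot_cdf_bounds: "0 \<le> boot_cdf G n y t" "boot_cdf G n y t \<le> 1"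
proof -
  show "0 \<le> boot_cdf G n y t" unfolding boot_cdf_def by (intro divide_nonneg_nonneg sum_nonneg) auto
  have "(\<Sum>v\<in>signs G. if clTstar G n y v \<le> t then 1 else 0) \<le> (\<Sum>v\<in>signs G. 1 :: real)"
    by (intro sum_mono) auto
  then show "boot_cdf G n y t \<le> 1" unfolding boot_cdf_def by (simp add: card_signs)
qed

lemma boot_cdf_right_continuous: "(boot_cdf G n y \<longlongrightarrow> boot_cdf G n y t) (at_right t)"
proof -
  have "((\<lambda>s. if c \<le> s then 1 else 0 :: real) \<longlongrightarrow> (if c \<le> t then 1 else 0)) (at_right t)" for c :: real
  proof (rule tendsto_eventually, cases "c \<le> t")
    case True
    then show "\<forall>\<^sub>F s in at_right t. (if c \<le> s then 1 else 0) = (if c \<le> t then 1 else 0 :: real)"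
      by (auto intro!: eventually_at_rightI[of t "t + 1"])
  next
    case False
    then show "\<forall>\<^sub>F s in at_right t. (if c \<le> s then 1 else 0) = (if c \<le> t then 1 else 0 :: real)"
      by (auto intro!: eventually_at_rightI[of t c])
  qed
  then show ?thesis unfolding boot_cdf_def by (intro tendsto_intros) auto
qed

lemma sum_diff_two_blocks:
  fixes f :: "nat \<Rightarrow> real"
  shows "g \<in> {..<m} \<Longrightarrow> (\<Sum>h\<in>{..<2 * m} - {g}. f h) = (\<Sum>h\<in>{..<m} - {g}. f h) + (\<Sum>h\<in>{m..<2 * m}. f h)"
    and "g \<in> {..<m} \<Longrightarrow> g' \<in> {m..<2 * m} \<Longrightarrow>
      (\<Sum>h\<in>{..<2 * m} - {g, g'}. f h) = (\<Sum>h\<in>{..<m} - {g}. f h) + (\<Sum>h\<in>{m..<2 * m} - {g'}. f h)"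
proof -
  assume g: "g \<in> {..<m}"
  have "{..<2 * m} - {g} = ({..<m} - {g}) \<union> {m..<2 * m}" using g by auto
  moreover have "({..<m} - {g}) \<inter> {m..<2 * m} = {}" by auto
  ultimately show "(\<Sum>h\<in>{..<2 * m} - {g}. f h) = (\<Sum>h\<in>{..<m} - {g}. f h) + (\<Sum>h\<in>{m..<2 * m}. f h)"
    by (simp add: sum.union_disjoint)
next
  assume g: "g \<in> {..<m}" "g' \<in> {m..<2 * m}"
  have "{..<2 * m} - {g, g'} = ({..<m} - {g}) \<union> ({m..<2 * m} - {g'})" using g by auto
  moreover have "({..<m} - {g}) \<inter> ({m..<2 * m} - {g'}) = {}" by auto
  ultimately show "(\<Sum>h\<in>{..<2 * m} - {g, g'}. f h) = (\<Sum>h\<in>{..<m} - {g}. f h) + (\<Sum>h\<in>{m..<2 * m} - {g'}. f h)"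
    by (simp add: sum.union_disjoint)
qed

section \<open>Inconsistency of the bootstrap\<close>

lemma clTstar_measurable:
  assumes N[measurable]: "\<And>g. (\<lambda>\<omega>. real (N g \<omega>)) \<in> borel_measurable M"
    and S[measurable]: "\<And>g. (\<lambda>\<omega>. \<Sum>i<N g \<omega>. Y g i \<omega>) \<in> borel_measurable M"
    and v: "v \<in> signs G"
  shows "(\<lambda>\<omega>. clTstar G (\<lambda>g. N g \<omega>) (\<lambda>g i. Y g i \<omega>) v) \<in> borel_measurable M"
  unfolding clTstar_eq[OF v refl] L2_set_def by measurable

lemma clT_measurable:
  assumes N[measurable]: "\<And>g. (\<lambda>\<omega>. real (N g \<omega>)) \<in> borel_measurable M"
    and S[measurable]: "\<And>g. (\<lambda>\<omega>. \<Sum>i<N g \<omega>. Y g i \<omega>) \<in> borel_measurable M"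
  shows "(\<lambda>\<omega>. clT G (\<lambda>g. N g \<omega>) (\<lambda>g i. Y g i \<omega>)) \<in> borel_measurable M"
  unfolding clT_eq[OF refl] L2_set_def by measurable

lemma boot_cdf_measurable:
  assumes N: "\<And>g. (\<lambda>\<omega>. real (N g \<omega>)) \<in> borel_measurable M"
    and S: "\<And>g. (\<lambda>\<omega>. \<Sum>i<N g \<omega>. Y g i \<omega>) \<in> borel_measurable M"
  shows "(\<lambda>\<omega>. boot_cdf G (\<lambda>g. N g \<omega>) (\<lambda>g i. Y g i \<omega>) t) \<in> borel_measurable M"
  unfolding boot_cdf_def
proof (intro borel_measurable_divide borel_measurable_sum borel_measurable_const)
  fix v assume v: "v \<in> signs G"
  note [measurable] = clTstar_measurable[OF N S v]
  show "(\<lambda>\<omega>. if clTstar G (\<lambda>g. N g \<omega>) (\<lambda>g i. Y g i \<omega>) v \<le> t then 1 else 0) \<in> borel_measurable M"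
    by measurable
qed

lemma bdd_above_abs_diff:
  fixes f h :: "real \<Rightarrow> real"
  assumes "\<And>t. 0 \<le> f t" "\<And>t. f t \<le> 1" "\<And>t. 0 \<le> h t" "\<And>t. h t \<le> 1"
  shows "bdd_above (range (\<lambda>t. \<bar>f t - h t\<bar>))"
proof (rule bdd_aboveI2)
  show "\<bar>f t - h t\<bar> \<le> 1" for t using assms(1,2)[of t] assms(3,4)[of t] by linarith
qed

text \<open>Measurability is needed here: \<open>measure\<close> is 0 outside the \<open>\<sigma>\<close>-algebra.\<close>
lemma sup_distance_event:
  assumes f_meas: "\<And>t. (\<lambda>\<omega>. f \<omega> t) \<in> borel_measurable M"
    and f: "\<And>\<omega> t. 0 \<le> f \<omega> t" "\<And>\<omega> t. f \<omega> t \<le> 1" "\<And>\<omega> t. (f \<omega> \<longlongrightarrow> f \<omega> t) (at_right t)"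
    and h: "\<And>t. 0 \<le> h t" "\<And>t. h t \<le> 1" "\<And>t. (h \<longlongrightarrow> h t) (at_right t)"
  shows "{\<omega> \<in> space M. (SUP t::real. \<bar>f \<omega> t - h t\<bar>) > (\<epsilon>::real)} \<in> sets M"
proof -
  note [measurable] = f_meas
  have "\<epsilon> < (SUP t. \<bar>f \<omega> t - h t\<bar>) \<longleftrightarrow> (\<exists>t\<in>\<rat>. \<epsilon> < \<bar>f \<omega> t - h t\<bar>)" for \<omega>
  proof -
    have "\<epsilon> < (SUP t. \<bar>f \<omega> t - h t\<bar>) \<longleftrightarrow> (\<exists>t. \<epsilon> < \<bar>f \<omega> t - h t\<bar>)"
      using f h by (subst less_cSUP_iff) (auto intro: bdd_above_abs_diff)
    also have "\<dots> \<longleftrightarrow> (\<exists>t\<in>\<rat>. \<epsilon> < \<bar>f \<omega> t - h t\<bar>)"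
    proof -
      have "((\<lambda>t. \<bar>f \<omega> t - h t\<bar>) \<longlongrightarrow> \<bar>f \<omega> t - h t\<bar>) (at_right t)" for t
        by (intro tendsto_intros f h)
      then show ?thesis using right_continuous_rational_witness by blast
    qed
    finally show ?thesis .
  qed
  then have "{\<omega> \<in> space M. (SUP t. \<bar>f \<omega> t - h t\<bar>) > \<epsilon>} = (\<Union>t\<in>\<rat>. {\<omega> \<in> space M. \<epsilon> < \<bar>f \<omega> t - h t\<bar>})"
    by auto
  also have "\<dots> \<in> sets M" by (intro sets.countable_UN'' countable_rat) measurable
  finally show ?thesis .
qed

lemma (in prob_space) exists_outside_exceptional:
  assumes "A \<in> events" "B \<in> events" "E \<in> events" "prob A + prob B < prob E"
  shows "\<exists>\<omega>\<in>E. \<omega> \<notin> A \<and> \<omega> \<notin> B"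
proof (rule ccontr)
  assume "\<not> ?thesis"
  then have "E \<subseteq> A \<union> B" by blast
  then have "prob E \<le> prob (A \<union> B)" using assms by (intro finite_measure_mono) auto
  also have "\<dots> \<le> prob A + prob B" using assms by (intro measure_Un_le)
  finally show False using assms by simp
qed

theorem theoremA2:
  fixes M :: "'a measure"
    and N :: "nat \<Rightarrow> 'a \<Rightarrow> nat"
    and Y :: "nat \<Rightarrow> nat \<Rightarrow> 'a \<Rightarrow> real"
    and \<alpha> :: real
  assumes "prob_space M"
    and N_meas: "\<And>g. N g \<in> measurable M (count_space UNIV)"
    and Y_meas: "\<And>g i. Y g i \<in> borel_measurable M"
    and N_pos: "\<And>g \<omega>. \<omega> \<in> space M \<Longrightarrow> N g \<omega> \<ge> 1"
    and indep: "prob_space.indep_vars M (\<lambda>_. borel)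
                  (\<lambda>g \<omega>. (real (N g \<omega>), \<Sum>i<N g \<omega>. Y g i \<omega>)) UNIV"
    and ident: "\<And>g. distr M borel (\<lambda>\<omega>. (real (N g \<omega>), \<Sum>i<N g \<omega>. Y g i \<omega>))
                     = distr M borel (\<lambda>\<omega>. (real (N 0 \<omega>), \<Sum>i<N 0 \<omega>. Y 0 i \<omega>))"
    and mean_N: "\<exists>c>0. integrable M (\<lambda>\<omega>. real (N 0 \<omega>)) \<and>
                   prob_space.expectation M (\<lambda>\<omega>. real (N 0 \<omega>)) = c"
    and null: "integrable M (\<lambda>\<omega>. \<Sum>i<N 0 \<omega>. Y 0 i \<omega>)"
              "prob_space.expectation M (\<lambda>\<omega>. \<Sum>i<N 0 \<omega>. Y 0 i \<omega>) = 0"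
    and alpha: "1 < \<alpha>" "\<alpha> < 2"
    and doa_N: "stable_DoA M (\<lambda>g \<omega>. real (N g \<omega>)) \<alpha>"
    and doa_S: "stable_DoA M (\<lambda>g \<omega>. \<Sum>i<N g \<omega>. Y g i \<omega>) \<alpha>"
  shows "\<not> (\<forall>\<epsilon>>0. (\<lambda>G. measure M {\<omega> \<in> space M.
            (SUP t::real. \<bar>boot_cdf G (\<lambda>g. N g \<omega>) (\<lambda>g i. Y g i \<omega>) t
               - measure M {\<omega>' \<in> space M. clT G (\<lambda>g. N g \<omega>') (\<lambda>g i. Y g i \<omega>') \<le> t}\<bar>) > \<epsilon>})
          \<longlonglongrightarrow> 0)"
proof
  interpret prob_space M by fact
  define S where "S = (\<lambda>g \<omega>. \<Sum>i<N g \<omega>. Y g i \<omega>)"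
  define F where "F = (\<lambda>G t. prob {\<omega> \<in> space M. clT G (\<lambda>g. N g \<omega>) (\<lambda>g i. Y g i \<omega>) \<le> t})"
  define bc where "bc = (\<lambda>G \<omega>. boot_cdf G (\<lambda>g. N g \<omega>) (\<lambda>g i. Y g i \<omega>))"
  \<comment> \<open>Outside \<open>Bad\<close> two bootstrap values differ by at most 2/32 = 1/16,
    which is less than the gap 15/16 - 13/16 = 1/8.\<close>
  define Bad where "Bad = (\<lambda>G. {\<omega> \<in> space M. (SUP t::real. \<bar>bc G \<omega> t - F G t\<bar>) > 1 / 32})"
  define \<nu> where "\<nu> = distr M borel (S 0)"
  assume "\<forall>\<epsilon>>0. (\<lambda>G. measure M {\<omega> \<in> space M.
            (SUP t::real. \<bar>boot_cdf G (\<lambda>g. N g \<omega>) (\<lambda>g i. Y g i \<omega>) t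
               - measure M {\<omega>' \<in> space M. clT G (\<lambda>g. N g \<omega>') (\<lambda>g i. Y g i \<omega>') \<le> t}\<bar>) > \<epsilon>})
          \<longlonglongrightarrow> 0"
  then have Bad0: "(\<lambda>G. prob (Bad G)) \<longlonglongrightarrow> 0"
    unfolding Bad_def bc_def F_def by (elim allE[of _ "1 / 32"]) simp
  have N[measurable]: "(\<lambda>\<omega>. real (N g \<omega>)) \<in> borel_measurable M" for g
    by (rule measurable_compose[OF N_meas]) simp
  have S[measurable]: "S g \<in> borel_measurable M" for g
    unfolding S_def
    by (rule measurable_compose_countable[where f = "\<lambda>n \<omega>. \<Sum>i<n. Y g i \<omega>" and g = "N g", OF _ N_meas])
       (intro borel_measurable_sum Y_meas)
  note S' = S[unfolded S_def]
  have pair[measurable]: "(\<lambda>\<omega>. (real (N g \<omega>), S g \<omega>)) \<in> borel_measurable M" for g by measurable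
  have snd_m: "snd \<in> borel_measurable (borel :: (real \<times> real) measure)"
    and fst_m: "fst \<in> borel_measurable (borel :: (real \<times> real) measure)"
    by (intro borel_measurable_continuous_onI continuous_intros)+
  have indep_S: "indep_vars (\<lambda>_. borel) S UNIV"
    using indep_vars_compose2[OF indep, of "\<lambda>_. snd" "\<lambda>_. borel"] snd_m by (simp add: S_def)
  have ident': "distr M borel (\<lambda>\<omega>. (real (N g \<omega>), S g \<omega>)) = distr M borel (\<lambda>\<omega>. (real (N 0 \<omega>), S 0 \<omega>))" for g
    unfolding S_def by (rule ident)
  have law_S: "distr M borel (S g) = distr (distr M borel (\<lambda>\<omega>. (real (N g \<omega>), S g \<omega>))) borel snd"
    and law_N: "distr M borel (\<lambda>\<omega>. real (N g \<omega>)) = distr (distr M borel (\<lambda>\<omega>. (real (N g \<omega>), S g \<omega>))) borel fst" for g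
    using distr_distr[OF snd_m pair[of g]] distr_distr[OF fst_m pair[of g]] by (simp_all add: comp_def)
  have ident_S: "distr M borel (S g) = \<nu>" for g
    unfolding \<nu>_def law_S[of g] law_S[of 0] ident'[of g] ..
  have ident_N: "distr M borel (\<lambda>\<omega>. real (N g \<omega>)) = distr M borel (\<lambda>\<omega>. real (N 0 \<omega>))" for g
    unfolding law_N[of g] law_N[of 0] ident'[of g] ..
  have Fb: "0 \<le> F G t" "F G t \<le> 1" for G t by (auto simp: F_def)
  have bcb: "0 \<le> bc G \<omega> t" "bc G \<omega> t \<le> 1" for G \<omega> t by (auto simp: bc_def boot_cdf_bounds)
  have Bad_meas[measurable]: "Bad G \<in> events" for G
    unfolding Bad_def
  proof (rule sup_distance_event)
    show "(\<lambda>\<omega>. bc G \<omega> t) \<in> borel_measurable M" for t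
      unfolding bc_def by (rule boot_cdf_measurable[OF N S'])
    show "(bc G \<omega> \<longlongrightarrow> bc G \<omega> t) (at_right t)" for \<omega> t
      unfolding bc_def by (rule boot_cdf_right_continuous)
    note [measurable] = clT_measurable[OF N S', of G]
    let ?D = "distr M borel (\<lambda>\<omega>. clT G (\<lambda>g. N g \<omega>) (\<lambda>g i. Y g i \<omega>))"
    interpret D: real_distribution ?D by (rule real_distribution_distr) measurable
    have "F G = cdf ?D"
      by (rule ext) (auto simp: F_def cdf_def measure_distr intro!: arg_cong[where f = prob])
    then show "(F G \<longlongrightarrow> F G t) (at_right t)" for t
      using D.cdf_is_right_cont[of t] by (simp add: continuous_within)
  qed (use Fb bcb in auto)
  have notBad: "\<bar>bc G \<omega> t - F G t\<bar> \<le> 1 / 32" if "\<omega> \<in> space M" "\<omega> \<notin> Bad G" for G \<omega> t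
  proof -
    have "\<bar>bc G \<omega> t - F G t\<bar> \<le> (SUP t. \<bar>bc G \<omega> t - F G t\<bar>)"
      by (intro cSUP_upper bdd_above_abs_diff bcb Fb) simp
    also have "\<dots> \<le> 1 / 32" using that by (simp add: Bad_def not_less)
    finally show ?thesis .
  qed

  have doa: "integrable M (S 0)" "0 < \<alpha>" "stable_DoA M S \<alpha>" using null doa_S alpha by (simp_all add: S_def)
  obtain R where R: "1 \<le> R" and window: "\<forall>\<eta>. 0 < \<eta> \<and> \<eta> \<le> 1 \<longrightarrow> (\<exists>p>0. \<exists>a. \<forall>\<^sub>F k in sequentially. 0 < a k \<and>
     p \<le> 2 ^ k * measure \<nu> {x. a k < \<bar>x\<bar> \<and> \<bar>x\<bar> \<le> R * a k} \<and>
     2 ^ k * (\<integral>x. min 1 (x\<^sup>2 / (\<eta> * (a k)\<^sup>2)) \<partial>\<nu>) \<le> 1 / 2)"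
    using stable_DoA_tail_window[OF indep_S ident_S doa(1,2) alpha(2) doa(3)] by (elim exE conjE) (rule that)
  define \<rho> where "\<rho> = 1 / (32 * R)"
  \<comment> \<open>The dominance lemmas allow \<open>(\<rho> / 4)\<^sup>2 / 16\<close> for the
    remaining squares; each of the two halves receives half of that.\<close>
  define \<eta> where "\<eta> = (\<rho> / 4)\<^sup>2 / 32"
  have \<rho>: "0 < \<rho>" "\<rho> \<le> 1 / 32" using R by (auto simp: \<rho>_def field_simps)
  have \<eta>: "0 < \<eta>" "\<eta> \<le> 1"
  proof -
    have "(\<rho> / 4)\<^sup>2 \<le> 1\<^sup>2" using \<rho> by (intro power_mono) auto
    then show "0 < \<eta>" "\<eta> \<le> 1" using \<rho> by (auto simp: \<eta>_def)
  qed
  obtain p a where p: "0 < p" and win: "\<forall>\<^sub>F k in sequentially. 0 < a k \<and>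
     p \<le> 2 ^ k * measure \<nu> {x. a k < \<bar>x\<bar> \<and> \<bar>x\<bar> \<le> R * a k} \<and>
     2 ^ k * (\<integral>x. min 1 (x\<^sup>2 / (\<eta> * (a k)\<^sup>2)) \<partial>\<nu>) \<le> 1 / 2"
    using window[rule_format, OF conjI[OF \<eta>]] by (elim exE conjE) (rule that)
  \<comment> \<open>Outside \<open>Big\<close> the residual correction has relative size
    \<open>\<delta> = \<rho> / 4\<close>.\<close>
  define Big where "Big = (\<lambda>G. {\<omega> \<in> space M. \<exists>g<G. (\<rho> / 4)\<^sup>2 * real G < real (N g \<omega>)})"
  have Big_meas[measurable]: "Big G \<in> events" for G unfolding Big_def by measurable
  have Big0: "(\<lambda>G. prob (Big G)) \<longlonglongrightarrow> 0"
  proof -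
    have le: "prob (Big G) \<le> real G * prob {\<omega> \<in> space M. (\<rho> / 4)\<^sup>2 * real G < real (N 0 \<omega>)}" for G
    proof -
      let ?E = "\<lambda>g. {\<omega> \<in> space M. (\<rho> / 4)\<^sup>2 * real G < real (N g \<omega>)}"
      have "prob (Big G) = prob (\<Union>g\<in>{..<G}. ?E g)" unfolding Big_def by (intro arg_cong[where f = prob]) auto
      also have "\<dots> \<le> (\<Sum>g<G. prob (?E g))" by (intro measure_UNION_le) auto
      also have "\<dots> = (\<Sum>g<G. prob (?E 0))"
      proof (intro sum.cong refl)
        fix g
        have "prob (?E h) = measure (distr M borel (\<lambda>\<omega>. real (N h \<omega>))) {(\<rho> / 4)\<^sup>2 * real G<..}" for h
          by (subst measure_distr) (auto intro!: arg_cong[where f = prob])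
        then show "prob (?E g) = prob (?E 0)" by (simp add: ident_N[of g])
      qed
      finally show ?thesis by simp
    qed
    have lim: "(\<lambda>G. real G * prob {\<omega> \<in> space M. (\<rho> / 4)\<^sup>2 * real G < real (N 0 \<omega>)}) \<longlonglongrightarrow> 0"
      using mean_N \<rho> by (intro integrable_tail_prob) auto
    show ?thesis by (rule tendsto_sandwich[OF _ _ tendsto_const lim]) (simp_all add: le)
  qed
  \<comment> \<open>Half of the lower bounds \<open>p / 4\<close> and \<open>p * p / 4\<close> for
    \<open>E1\<close> and \<open>E2\<close>, so the two exceptional events together cannot cover
    either.\<close>
  define m where "m = min (p / 8) (p * p / 8)"
  have m: "0 < m" using p by (simp add: m_def)
  have sub: "filterlim (\<lambda>k. 2 * 2 ^ k :: nat) sequentially sequentially"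
    by (intro filterlim_subseq) (simp add: strict_mono_def)
  have "\<forall>\<^sub>F k in sequentially. prob (Bad (2 * 2 ^ k)) < m"
    by (rule order_tendstoD(2)[OF filterlim_compose[OF Bad0 sub] m])
  moreover have "\<forall>\<^sub>F k in sequentially. prob (Big (2 * 2 ^ k)) < m"
    by (rule order_tendstoD(2)[OF filterlim_compose[OF Big0 sub] m])
  ultimately have "\<forall>\<^sub>F k in sequentially. prob (Bad (2 * 2 ^ k)) < m \<and> prob (Big (2 * 2 ^ k)) < m \<and> 0 < a k \<and>
     p \<le> 2 ^ k * measure \<nu> {x. a k < \<bar>x\<bar> \<and> \<bar>x\<bar> \<le> R * a k} \<and>
     2 ^ k * (\<integral>x. min 1 (x\<^sup>2 / (\<eta> * (a k)\<^sup>2)) \<partial>\<nu>) \<le> 1 / 2"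
    using win by eventually_elim auto
  then obtain k where k: "prob (Bad (2 * 2 ^ k)) < m" "prob (Big (2 * 2 ^ k)) < m" "0 < a k"
     "p \<le> 2 ^ k * measure \<nu> {x. a k < \<bar>x\<bar> \<and> \<bar>x\<bar> \<le> R * a k}"
     "2 ^ k * (\<integral>x. min 1 (x\<^sup>2 / (\<eta> * (a k)\<^sup>2)) \<partial>\<nu>) \<le> 1 / 2"
    by (auto simp: eventually_sequentially)
  define n :: nat where "n = 2 ^ k"
  define A where "A = a k"
  define b where "b = \<eta> * A\<^sup>2"
  \<comment> \<open>Disjoint halves of equal size: events on them are independent, and the estimate
    for \<open>2 ^ k\<close> clusters applies to each.\<close>
  define I1 where "I1 = {..<n}"
  define I2 where "I2 = {n..<2 * n}"
  define Dom where "Dom = (\<lambda>(I :: nat set) x. \<exists>g\<in>I. A < \<bar>x g :: real\<bar> \<and> \<bar>x g\<bar> \<le> R * A \<and> (\<Sum>h\<in>I - {g}. (x h)\<^sup>2) \<le> b)"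
  define Sm where "Sm = (\<lambda>(I :: nat set) x. (\<Sum>h\<in>I. (x h :: real)\<^sup>2) \<le> b)"
  have A0: "0 < A" using k by (simp add: A_def)
  have b: "0 < b" "b \<le> A\<^sup>2"
    using A0 \<eta> mult_right_mono[OF \<eta>(2), of "A\<^sup>2"] by (auto simp: b_def)
  have card: "real (card I1) = 2 ^ k" "real (card I2) = 2 ^ k" by (auto simp: I1_def I2_def n_def)
  have fin: "finite I1" "finite I2" "I1 \<inter> I2 = {}" by (auto simp: I1_def I2_def)
  have dom: "p / 2 \<le> prob {\<omega> \<in> space M. Dom I (\<lambda>g. S g \<omega>)}" if "I = I1 \<or> I = I2" for I
    unfolding Dom_def using that k fin card b A0
    by (intro prob_one_dominant[OF indep_S ident_S]) (auto simp: A_def b_def)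
  have sm: "1 / 2 \<le> prob {\<omega> \<in> space M. Sm I2 (\<lambda>g. S g \<omega>)}"
    unfolding Sm_def using k fin card b
    by (intro prob_sum_squares_le_half[OF S ident_S]) (auto simp: A_def b_def)
  have Dom_restrict: "Dom I (restrict x I) = Dom I x" and Sm_restrict: "Sm I (restrict x I) = Sm I x" for I x
    by (auto simp: Dom_def Sm_def cong: sum.cong_simp bex_cong)
  have Dom_meas: "Measurable.pred (PiM I (\<lambda>_. borel)) (Dom I)" and Sm_meas: "Measurable.pred (PiM I (\<lambda>_. borel)) (Sm I)"
    if "finite I" for I unfolding Dom_def Sm_def using that by measurable
  \<comment> \<open>\<open>E1\<close> has one dominant cluster in the whole sample,
    \<open>E2\<close> a comparable pair.\<close>
  define E1 where "E1 = {\<omega> \<in> space M. Dom I1 (\<lambda>g. S g \<omega>) \<and> Sm I2 (\<lambda>g. S g \<omega>)}"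
  define E2 where "E2 = {\<omega> \<in> space M. Dom I1 (\<lambda>g. S g \<omega>) \<and> Dom I2 (\<lambda>g. S g \<omega>)}"
  have E_meas: "E1 \<in> events" "E2 \<in> events"
    unfolding E1_def E2_def Dom_def Sm_def using fin by measurable
  have "prob E1 = prob {\<omega> \<in> space M. Dom I1 (\<lambda>g. S g \<omega>)} * prob {\<omega> \<in> space M. Sm I2 (\<lambda>g. S g \<omega>)}"
    using prob_disjoint_blocks[OF indep_S fin(3) Dom_meas[OF fin(1)] Sm_meas[OF fin(2)]]
    by (simp add: E1_def Dom_restrict Sm_restrict)
  moreover have "p / 2 * (1 / 2) \<le> prob {\<omega> \<in> space M. Dom I1 (\<lambda>g. S g \<omega>)} * prob {\<omega> \<in> space M. Sm I2 (\<lambda>g. S g \<omega>)}"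
    using dom sm p by (intro mult_mono) auto
  ultimately have "prob (Bad (2 * n)) + prob (Big (2 * n)) < prob E1"
    using k(1,2) by (simp add: n_def m_def)
  then obtain \<omega>1 where \<omega>1: "\<omega>1 \<in> E1" "\<omega>1 \<notin> Bad (2 * n)" "\<omega>1 \<notin> Big (2 * n)"
    using exists_outside_exceptional[OF Bad_meas Big_meas E_meas(1)] by blast
  have "prob E2 = prob {\<omega> \<in> space M. Dom I1 (\<lambda>g. S g \<omega>)} * prob {\<omega> \<in> space M. Dom I2 (\<lambda>g. S g \<omega>)}"
    using prob_disjoint_blocks[OF indep_S fin(3) Dom_meas[OF fin(1)] Dom_meas[OF fin(2)]]
    by (simp add: E2_def Dom_restrict)
  moreover have "p / 2 * (p / 2) \<le> prob {\<omega> \<in> space M. Dom I1 (\<lambda>g. S g \<omega>)} * prob {\<omega> \<in> space M. Dom I2 (\<lambda>g. S g \<omega>)}"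
    using dom p by (intro mult_mono) auto
  ultimately have "prob (Bad (2 * n)) + prob (Big (2 * n)) < prob E2"
    using k(1,2) by (simp add: n_def m_def)
  then obtain \<omega>2 where \<omega>2: "\<omega>2 \<in> E2" "\<omega>2 \<notin> Bad (2 * n)" "\<omega>2 \<notin> Big (2 * n)"
    using exists_outside_exceptional[OF Bad_meas Big_meas E_meas(2)] by blast
  have sp: "\<omega>1 \<in> space M" "\<omega>2 \<in> space M" using \<omega>1 \<omega>2 by (auto simp: E1_def E2_def)
  have Nle: "real (N g \<omega>) \<le> (\<rho> / 4)\<^sup>2 * real (2 * n)" if "g < 2 * n" "\<omega> \<in> space M" "\<omega> \<notin> Big (2 * n)" for g \<omega>
    using that unfolding Big_def by (metis (mono_tags, lifting) mem_Collect_eq not_less)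
  have bb: "b + b = (\<rho> / 4)\<^sup>2 / 16 * A\<^sup>2" by (simp add: b_def \<eta>_def)
  have hi: "15 / 16 \<le> bc (2 * n) \<omega>1 (1 + \<rho>)"
  proof -
    obtain g where g: "g \<in> I1" "A < \<bar>S g \<omega>1\<bar>" "(\<Sum>h\<in>I1 - {g}. (S h \<omega>1)\<^sup>2) \<le> b"
      and r: "(\<Sum>h\<in>I2. (S h \<omega>1)\<^sup>2) \<le> b"
      using \<omega>1 by (auto simp: E1_def Dom_def Sm_def)
    have "(\<Sum>h\<in>{..<2 * n} - {g}. (S h \<omega>1)\<^sup>2) \<le> b + b"
      using g r sum_diff_two_blocks(1)[of g n "\<lambda>h. (S h \<omega>1)\<^sup>2"] by (simp add: I1_def I2_def)
    then show ?thesis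
      unfolding bc_def bb using g(1,2) A0 \<rho> N_pos[OF sp(1)] Nle[OF _ sp(1) \<omega>1(3)]
      by (intro boot_cdf_one_dominant[where s = "\<lambda>g. S g \<omega>1" and a = A and ?g0.0 = g]) (auto simp: S_def I1_def)
  qed
  have lo: "bc (2 * n) \<omega>2 (1 + \<rho>) \<le> 13 / 16"
  proof -
    obtain g g' where g: "g \<in> I1" "A < \<bar>S g \<omega>2\<bar>" "\<bar>S g \<omega>2\<bar> \<le> R * A" "(\<Sum>h\<in>I1 - {g}. (S h \<omega>2)\<^sup>2) \<le> b"
      and g': "g' \<in> I2" "A < \<bar>S g' \<omega>2\<bar>" "\<bar>S g' \<omega>2\<bar> \<le> R * A" "(\<Sum>h\<in>I2 - {g'}. (S h \<omega>2)\<^sup>2) \<le> b"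
      using \<omega>2 by (auto simp: E2_def Dom_def)
    have "(\<Sum>h\<in>{..<2 * n} - {g, g'}. (S h \<omega>2)\<^sup>2) \<le> b + b"
      using g g' sum_diff_two_blocks(2)[of g n g' "\<lambda>h. (S h \<omega>2)\<^sup>2"] by (simp add: I1_def I2_def)
    then show ?thesis
      unfolding bc_def bb using g(1-3) g'(1-3) A0 R \<rho>_def N_pos[OF sp(2)] Nle[OF _ sp(2) \<omega>2(3)]
      by (intro boot_cdf_two_dominant[where s = "\<lambda>g. S g \<omega>2" and a = A and ?g1.0 = g and ?g2.0 = g' and R = R])
         (auto simp: S_def I1_def I2_def)
  qed
  \<comment> \<open>Both outcomes use the same \<open>F (2 * n)\<close> at
    \<open>1 + \<rho>\<close>, which cannot be within 1/32 of both bootstrap values.\<close>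
  show False
    using hi lo notBad[OF sp(1) \<omega>1(2), of "1 + \<rho>"] notBad[OF sp(2) \<omega>2(2), of "1 + \<rho>"] by linarith
qed

end
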